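(* There exist an adaptive randomized algorithm and an adaptive deterministic algorithm that solve the Graph Reconstruction problem with a CC oracle using $\mathcal{O}(d^2 \log^2 n)$ and $\mathcal{O}\big(d^3 \log(n)\log(n/d)\big)$ CC queries, respectively, where $n$ is the number of vertices and $d$ is the degeneracy of the hidden graph (and $d$ is not given to the algorithms). The output of the randomized algorithm is correct with high probability.
   Context: Graph Reconstruction (GR): an unknown ("hidden") simple undirected graph $G=(V,E)$ on a known vertex set $V$ with $|V|=n$ is to be determined; the algorithm must output $E$. It accesses $G$ only through a connected components (CC) oracle: a query is a set $S\subseteq V$, and the answer is the partition of $S$ into the vertex sets of the connected components of the induced subgraph $G[S]$. Complexity is measured by the number of queries. An algorithm is adaptive if later queries may depend on answers to earlier ones. A randomized algorithm is correct with high probability if the probability that it outputs the hidden graph tends to $1$ as $n\to\infty$; a deterministic algorithm must always output the hidden graph. The degeneracy $d$ of a graph is the smallest integer such that every induced subgraph has a vertex of degree at most $d$. *)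

theory Defs
  imports "HOL-Probability.Probability_Mass_Function"
begin

type_synonym 'v edges = "'v set set"

definition simple_graph :: "'v set \<Rightarrow> 'v edges \<Rightarrow> bool" where
  "simple_graph V E \<longleftrightarrow> E \<subseteq> {{u, v} | u v. u \<in> V \<and> v \<in> V \<and> u \<noteq> v}"

definition induced :: "'v edges \<Rightarrow> 'v set \<Rightarrow> 'v edges" where
  "induced E S = {e \<in> E. e \<subseteq> S}"

definition degree :: "'v edges \<Rightarrow> 'v \<Rightarrow> nat" where
  "degree E v = card {e \<in> E. v \<in> e}"

definition degeneracy :: "'v set \<Rightarrow> 'v edges \<Rightarrow> nat" where
  "degeneracy V E =
     (LEAST d. \<forall>S. S \<subseteq> V \<and> S \<noteq> {} \<longrightarrow> (\<exists>v\<in>S. degree (induced E S) v \<le> d))"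

definition connected_rel :: "'v edges \<Rightarrow> 'v set \<Rightarrow> ('v \<times> 'v) set" where
  "connected_rel E S = {(u, v). u \<in> S \<and> v \<in> S \<and> (u, v) \<in> {(x, y). {x, y} \<in> induced E S}\<^sup>*}"

definition cc_oracle :: "'v edges \<Rightarrow> 'v set \<Rightarrow> 'v set set" where
  "cc_oracle E S = S // connected_rel E S"

(* An adaptive deterministic algorithm for one fixed vertex set is a decision tree: it either
   outputs an edge set or submits a query and continues depending on the answer.  Only the answers
   carry information about the hidden graph.  Being a datatype, every tree halts on every
   sequence of answers. *)
datatype 'v cc_algorithm =
    Output "'v edges"
  | Query "'v set" "'v set set \<Rightarrow> 'v cc_algorithm"

primrec queries_within :: "'v set \<Rightarrow> 'v cc_algorithm \<Rightarrow> bool" where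
  "queries_within V (Output F) \<longleftrightarrow> True"
| "queries_within V (Query S next_step) \<longleftrightarrow> S \<subseteq> V \<and> (\<forall>P. queries_within V (next_step P))"

primrec output_on :: "'v cc_algorithm \<Rightarrow> 'v edges \<Rightarrow> 'v edges" where
  "output_on (Output F) E = F"
| "output_on (Query S next_step) E = output_on (next_step (cc_oracle E S)) E"

primrec num_queries_on :: "'v cc_algorithm \<Rightarrow> 'v edges \<Rightarrow> nat" where
  "num_queries_on (Output F) E = 0"
| "num_queries_on (Query S next_step) E = Suc (num_queries_on (next_step (cc_oracle E S)) E)"

(* Algorithms are families indexed by the number n of vertices, the known vertex set being {..<n};
   they receive no other parameter. *)
type_synonym det_algorithm = "nat \<Rightarrow> nat cc_algorithm"

(* A randomized algorithm draws all its coins in advance, i.e. it is a probability distribution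
   over decision trees. *)
type_synonym rand_algorithm = "nat \<Rightarrow> nat cc_algorithm pmf"

definition det_solves_GR :: "det_algorithm \<Rightarrow> bool" where
  "det_solves_GR A \<longleftrightarrow>
     (\<forall>n. queries_within {..<n} (A n) \<and>
          (\<forall>E. simple_graph {..<n} E \<longrightarrow> output_on (A n) E = E))"

(* The infimum over the finitely many hidden graphs on n vertices: the success probability tends
   to 1 uniformly in the hidden graph. *)
definition rand_solves_GR_whp :: "rand_algorithm \<Rightarrow> bool" where
  "rand_solves_GR_whp R \<longleftrightarrow>
     (\<forall>n. \<forall>T\<in>set_pmf (R n). queries_within {..<n} T) \<and>
     (\<lambda>n. INF E\<in>{E. simple_graph {..<n} E}. measure_pmf.prob (R n) {T. output_on T E = E})
       \<longlonglongrightarrow> 1"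

(* Edgeless graphs have degeneracy 0, where the bounds would read 0 or contain log (n/0),
   although at least one query is needed; they are charged as for degeneracy 1. *)
definition degeneracy1 :: "nat \<Rightarrow> nat edges \<Rightarrow> real" where
  "degeneracy1 n E = real (max 1 (degeneracy {..<n} E))"

end

theory Submission
  imports Defs "HOL-Probability.Product_PMF" "HOL-Library.Log_Nat"
begin

text \<open>
  Guess \<open>D\<close>, starting at 1 and doubling. If the degeneracy is at most \<open>D\<close>, at least half of the
  vertices in any vertex set \<open>W\<close> have \<open>O(D)\<close> neighbours in \<open>W\<close>. A set \<open>S\<close> that contains \<open>u\<close> and \<open>v\<close> but
  no neighbour of \<open>u\<close> isolates \<open>u\<close> and so reveals that \<open>uv\<close> is no edge. Random sets of density \<open>1/\<Theta>(D)\<close>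
  are such with probability \<open>\<Omega>(1/D\<^sup>2)\<close> if \<open>u\<close> has low degree, so that \<open>O(D\<^sup>2 log n)\<close> of them
  determine the neighbourhoods of all low vertices with high probability, and \<open>O(D\<^sup>3 log n)\<close> of
  them do so simultaneously for all graphs. The low vertices are peeled off, and after \<open>O(log n)\<close>
  such rounds no vertex is left or the guess is doubled. As to the factor \<open>log (n/d)\<close>, it is of order
  \<open>log n\<close> unless \<open>d\<^sup>3 > n\<^sup>2\<close>, and then querying all pairs is cheap enough.

  The query bound is required for every outcome of the coins, so a guess may only be doubled on proof
  that it was too small. The proof comes from the same answers: in a random family every
  pair of vertices lies in \<open>O(log n)\<close> of the sets, so a vertex seen non-isolated in
  \<open>\<Omega>(D log n)\<close> of them has \<open>\<Omega>(D)\<close> neighbours. If half of the vertices of \<open>W\<close> are of this kind, the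
  degeneracy is \<open>\<Omega>(D)\<close>; otherwise the randomized algorithm gives up.
\<close>

section \<open>Graphs and the connected components oracle\<close>

definition nbrs :: "'v edges \<Rightarrow> 'v set \<Rightarrow> 'v \<Rightarrow> 'v set" where
  "nbrs E W u = {v \<in> W. {u, v} \<in> E}"

lemma nbrs_subset: "nbrs E W u \<subseteq> W"
  by (auto simp: nbrs_def)

lemma simple_graph_loopfree: "simple_graph V E \<Longrightarrow> {u} \<notin> E"
  by (auto simp: simple_graph_def doubleton_eq_iff)

lemma simple_graph_edgeE:
  assumes "simple_graph V E" "e \<in> E"
  obtains u v where "u \<in> V" "v \<in> V" "u \<noteq> v" "e = {u, v}"
  using assms by (auto simp: simple_graph_def)

lemma self_notin_nbrs: "simple_graph V E \<Longrightarrow> u \<notin> nbrs E W u"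
  using simple_graph_loopfree[of V E u] by (auto simp: nbrs_def)

lemma degree_induced:
  assumes "simple_graph V E" "W \<subseteq> V" "u \<in> W"
  shows "degree (induced E W) u = card (nbrs E W u)"
proof -
  have "{e \<in> induced E W. u \<in> e} = (\<lambda>v. {u, v}) ` nbrs E W u"
  proof (intro equalityI subsetI)
    fix e assume "e \<in> {e \<in> induced E W. u \<in> e}"
    then have e: "e \<in> E" "e \<subseteq> W" "u \<in> e" by (auto simp: induced_def)
    obtain a b where ab: "a \<noteq> b" "e = {a, b}"
      using simple_graph_edgeE[OF assms(1) e(1)] by metis
    show "e \<in> (\<lambda>v. {u, v}) ` nbrs E W u"
    proof (cases "u = a")
      case True
      then show ?thesis using ab e by (auto simp: nbrs_def)
    next
      case False
      then have "u = b" using e ab by auto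
      then have "e = {u, a}" "a \<in> nbrs E W u" using ab e by (auto simp: nbrs_def insert_commute)
      then show ?thesis by blast
    qed
  qed (use assms in \<open>auto simp: nbrs_def induced_def\<close>)
  moreover have "inj_on (\<lambda>v. {u, v}) (nbrs E W u)"
    by (auto simp: inj_on_def doubleton_eq_iff)
  ultimately show ?thesis
    by (simp add: degree_def card_image)
qed

text \<open>Shows that the \<open>LEAST\<close> in \<open>degeneracy\<close> ranges over a nonempty
  set: without loops no degree exceeds \<open>card V - 1\<close>.\<close>

lemma exists_degree_le_card:
  assumes "finite V" "simple_graph V E" "S \<subseteq> V" "S \<noteq> {}"
  shows "\<exists>v\<in>S. degree (induced E S) v \<le> card V - 1"
proof -
  obtain v where v: "v \<in> S" using assms(4) by auto
  have "nbrs E S v \<subseteq> V - {v}"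
    using self_notin_nbrs[OF assms(2), of v S] nbrs_subset[of E S v] assms(3) by auto
  then have "card (nbrs E S v) \<le> card (V - {v})"
    using assms(1) by (intro card_mono) auto
  then show ?thesis
    using v assms by (auto simp: degree_induced card_Diff_singleton)
qed

lemma degeneracy_le_card:
  assumes "finite V" "simple_graph V E"
  shows "degeneracy V E \<le> card V - 1"
  unfolding degeneracy_def using exists_degree_le_card[OF assms] by (intro Least_le) auto

lemma degeneracy_witness:
  assumes "finite V" "simple_graph V E" "W \<subseteq> V" "W \<noteq> {}"
  shows "\<exists>v\<in>W. card (nbrs E W v) \<le> degeneracy V E"
proof -
  let ?P = "\<lambda>d. \<forall>S. S \<subseteq> V \<and> S \<noteq> {} \<longrightarrow> (\<exists>v\<in>S. degree (induced E S) v \<le> d)"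
  have "?P (card V - 1)" using exists_degree_le_card[OF assms(1,2)] by auto
  then have "?P (degeneracy V E)"
    unfolding degeneracy_def by (rule LeastI)
  then show ?thesis
    using assms by (metis degree_induced)
qed

text \<open>Delete a vertex whose degree is at most the degeneracy: the degree sum drops by twice
  its degree, once for the vertex and once for its neighbours.\<close>

lemma sum_card_nbrs_le:
  assumes "finite V" "simple_graph V E" "W \<subseteq> V"
  shows "(\<Sum>u\<in>W. card (nbrs E W u)) \<le> 2 * degeneracy V E * card W"
  using assms(3)
proof (induction "card W" arbitrary: W)
  case 0
  then show ?case using finite_subset[OF _ assms(1)] by auto
next
  case (Suc k W)
  have fin: "finite W" using Suc.prems assms(1) finite_subset by blast
  have "W \<noteq> {}" using Suc.hyps(2) by auto
  then obtain x where x: "x \<in> W" "card (nbrs E W x) \<le> degeneracy V E"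
    using degeneracy_witness[OF assms(1,2) Suc.prems] by auto
  let ?W = "W - {x}"
  have card_del: "card (nbrs E W u) = card (nbrs E ?W u) + (if u \<in> nbrs E W x then 1 else 0)"
    if "u \<in> ?W" for u
  proof (cases "u \<in> nbrs E W x")
    case True
    then have "nbrs E W u = insert x (nbrs E ?W u)"
      using x by (auto simp: nbrs_def insert_commute)
    moreover have "x \<notin> nbrs E ?W u" "finite (nbrs E ?W u)"
      using fin by (auto simp: nbrs_def)
    ultimately show ?thesis using True by simp
  next
    case False
    then have "nbrs E W u = nbrs E ?W u"
      using that by (auto simp: nbrs_def insert_commute)
    then show ?thesis using False by simp
  qed
  have "(\<Sum>u\<in>W. card (nbrs E W u)) = card (nbrs E W x) + (\<Sum>u\<in>?W. card (nbrs E W u))"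
    using fin x(1) by (simp add: sum.remove)
  also have "(\<Sum>u\<in>?W. card (nbrs E W u))
      = (\<Sum>u\<in>?W. card (nbrs E ?W u)) + (\<Sum>u\<in>?W. if u \<in> nbrs E W x then 1 else 0)"
    using card_del by (simp add: sum.distrib)
  also have "(\<Sum>u\<in>?W. if u \<in> nbrs E W x then 1 else 0) = card (?W \<inter> nbrs E W x)"
    using fin by (simp add: sum.If_cases)
  also have "?W \<inter> nbrs E W x = nbrs E W x"
    using self_notin_nbrs[OF assms(2), of x W] nbrs_subset[of E W x] by auto
  finally have "(\<Sum>u\<in>W. card (nbrs E W u))
      = 2 * card (nbrs E W x) + (\<Sum>u\<in>?W. card (nbrs E ?W u))" by simp
  also have "\<dots> \<le> 2 * degeneracy V E + 2 * degeneracy V E * card ?W"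
  proof (intro add_mono mult_left_mono x)
    show "(\<Sum>u\<in>?W. card (nbrs E ?W u)) \<le> 2 * degeneracy V E * card ?W"
    proof (rule Suc.hyps(1))
      show "k = card ?W" using Suc.hyps(2) x(1) fin by simp
    qed (use Suc.prems in auto)
  qed simp
  also have "\<dots> = 2 * degeneracy V E * card W"
    by (simp only: card.remove[OF fin x(1)]) simp
  finally show ?case .
qed

text \<open>The average degree in \<open>W\<close> is at most twice the degeneracy, so half of the
  vertices cannot all exceed four times it. Every raised guess is paid for by this.\<close>

lemma degeneracy_ge_of_many_high:
  assumes "finite V" "simple_graph V E" "W \<subseteq> V" "W \<noteq> {}"
    and A: "A \<subseteq> W" "card W \<le> 2 * card A" "\<And>u. u \<in> A \<Longrightarrow> k \<le> card (nbrs E W u)"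
  shows "k \<le> 4 * degeneracy V E"
proof -
  have fin: "finite W" using assms(1,3) finite_subset by blast
  have "k * card A \<le> (\<Sum>u\<in>A. card (nbrs E W u))"
    using sum_mono[of A "\<lambda>_. k"] A(3) by (simp add: mult.commute)
  also have "\<dots> \<le> (\<Sum>u\<in>W. card (nbrs E W u))"
    using fin A(1) by (intro sum_mono2) auto
  also have "\<dots> \<le> 2 * degeneracy V E * card W"
    by (rule sum_card_nbrs_le) fact+
  finally have "k * card A \<le> 2 * degeneracy V E * card W" .
  moreover have "k * card W \<le> k * (2 * card A)" using A(2) by (rule mult_left_mono) simp
  ultimately have "k * card W \<le> 4 * degeneracy V E * card W" by linarith
  then show ?thesis using fin assms(4) by (simp add: card_gt_0_iff)
qed

section \<open>Components of an induced subgraph\<close>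

lemma equiv_connected_rel: "equiv S (connected_rel E S)"
proof -
  let ?R = "{(x, y). {x, y} \<in> induced E S}"
  have "sym ?R" by (auto simp: sym_def insert_commute)
  then have "sym (?R\<^sup>*)" by (rule sym_rtrancl)
  then show ?thesis
    unfolding equiv_def refl_on_def sym_def trans_def connected_rel_def
    by (auto intro: rtrancl_trans)
qed

lemma Union_cc_oracle: "\<Union> (cc_oracle E S) = S"
  unfolding cc_oracle_def by (rule Union_quotient[OF equiv_connected_rel])

lemma edge_same_component:
  assumes "{u, v} \<in> E" "v \<in> S" "B \<in> cc_oracle E S" "u \<in> B"
  shows "v \<in> B"
proof -
  have "u \<in> \<Union> (cc_oracle E S)" using assms(3,4) by blast
  then have "u \<in> S" by (simp only: Union_cc_oracle)
  then have "(u, v) \<in> connected_rel E S"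
    using assms(1,2) by (auto simp: connected_rel_def induced_def)
  then show ?thesis
    using assms(3,4) equiv_connected_rel[of S E] unfolding cc_oracle_def
    by (metis in_quotient_imp_closed)
qed

lemma isolated_component:
  assumes "u \<in> S" "nbrs E S u = {}"
  shows "{u} \<in> cc_oracle E S"
proof -
  have "connected_rel E S `` {u} = {u}"
  proof -
    have "v = u" if "(u, v) \<in> {(x, y). {x, y} \<in> induced E S}\<^sup>*" for v
      using that
    proof (cases rule: converse_rtranclE)
      case (step y)
      then have "y \<in> nbrs E S u" by (auto simp: nbrs_def induced_def)
      then show ?thesis using assms by simp
    qed simp
    then show ?thesis using assms(1) by (auto simp: connected_rel_def)
  qed
  then show ?thesis using assms(1) unfolding cc_oracle_def quotient_def by auto
qed

section \<open>Non-edges and high degrees read off from the answers\<close>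

definition separated :: "'v set set list \<Rightarrow> 'v \<Rightarrow> 'v \<Rightarrow> bool" where
  "separated Ps u v \<longleftrightarrow> (\<exists>P\<in>set Ps. \<exists>B\<in>P. u \<in> B \<and> v \<in> \<Union> P - B)"

definition candidates :: "'v set set list \<Rightarrow> 'v set \<Rightarrow> 'v \<Rightarrow> 'v set" where
  "candidates Ps W u = {v \<in> W. v \<noteq> u \<and> \<not> separated Ps u v}"

definition nonisolated_count :: "'v set set list \<Rightarrow> 'v \<Rightarrow> nat" where
  "nonisolated_count Ps u = length (filter (\<lambda>P. u \<in> \<Union> P \<and> {u} \<notin> P) Ps)"

definition low_vertices :: "'v set set list \<Rightarrow> 'v set \<Rightarrow> nat \<Rightarrow> 'v set" where
  "low_vertices Ps W t = {u \<in> W. card (candidates Ps W u) \<le> t}"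

definition answers :: "'v edges \<Rightarrow> 'v set list \<Rightarrow> 'v set \<Rightarrow> 'v set set list" where
  "answers E Ss W = map (\<lambda>S. cc_oracle E (S \<inter> W)) Ss"

text \<open>\<open>\<Union> P\<close> recovers the query set from its answer, so
  \<open>separated\<close> is computable from answers alone; here it is traced back to the
  queries.\<close>

lemma separated_answers:
  "separated (answers E Ss W) u v \<longleftrightarrow>
    (\<exists>S\<in>set Ss. \<exists>B\<in>cc_oracle E (S \<inter> W). u \<in> B \<and> v \<in> S \<inter> W \<and> v \<notin> B)"
  by (simp only: separated_def answers_def set_map bex_simps Union_cc_oracle Diff_iff)

lemma nonisolated_count_answers:
  "nonisolated_count (answers E Ss W) u
    = length (filter (\<lambda>S. u \<in> S \<inter> W \<and> {u} \<notin> cc_oracle E (S \<inter> W)) Ss)"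
  by (simp only: nonisolated_count_def answers_def filter_map o_def Union_cc_oracle length_map)

text \<open>The ends of an edge share a component in every query containing both, so no family can
  eliminate a true neighbour; only false candidates may survive.\<close>

lemma nbrs_subset_candidates:
  assumes "simple_graph V E"
  shows "nbrs E W u \<subseteq> candidates (answers E Ss W) W u"
proof
  fix v assume v: "v \<in> nbrs E W u"
  have "\<not> separated (answers E Ss W) u v"
  proof
    assume "separated (answers E Ss W) u v"
    then obtain S B where "B \<in> cc_oracle E (S \<inter> W)" "u \<in> B" "v \<in> S \<inter> W" "v \<notin> B"
      unfolding separated_answers by blast
    then show False using v edge_same_component[of u v E "S \<inter> W" B] by (auto simp: nbrs_def)
  qed
  moreover have "v \<noteq> u" using v self_notin_nbrs[OF assms] by auto
  ultimately show "v \<in> candidates (answers E Ss W) W u"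
    using v by (auto simp: candidates_def nbrs_def)
qed

text \<open>Meant for \<open>N = nbrs E W u\<close>: in the query \<open>S \<inter> W\<close> such
  an \<open>S\<close> makes \<open>u\<close> a component of its own, with \<open>v\<close> outside
  of it.\<close>

definition isolating :: "'v set list \<Rightarrow> 'v \<Rightarrow> 'v \<Rightarrow> 'v set \<Rightarrow> bool" where
  "isolating Ss u v N \<longleftrightarrow> (\<exists>S\<in>set Ss. u \<in> S \<and> v \<in> S \<and> N \<inter> S = {})"

lemma candidates_eq_nbrs:
  assumes "simple_graph V E" "u \<in> W"
    and iso: "\<And>v. v \<in> W \<Longrightarrow> v \<noteq> u \<Longrightarrow> v \<notin> nbrs E W u \<Longrightarrow> isolating Ss u v (nbrs E W u)"
  shows "candidates (answers E Ss W) W u = nbrs E W u"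
proof (rule equalityI)
  show "candidates (answers E Ss W) W u \<subseteq> nbrs E W u"
  proof
    fix v assume v: "v \<in> candidates (answers E Ss W) W u"
    show "v \<in> nbrs E W u"
    proof (rule ccontr)
      assume "v \<notin> nbrs E W u"
      then obtain S where S: "S \<in> set Ss" "u \<in> S" "v \<in> S" "nbrs E W u \<inter> S = {}"
        using iso[of v] v by (auto simp: isolating_def candidates_def)
      have "nbrs E (S \<inter> W) u = {}" using S(4) by (auto simp: nbrs_def)
      then have "{u} \<in> cc_oracle E (S \<inter> W)"
        using S(2) assms(2) by (intro isolated_component) auto
      then have "separated (answers E Ss W) u v"
        using v S unfolding separated_answers candidates_def by blast
      then show False using v by (simp add: candidates_def)
    qed
  qed
qed (rule nbrs_subset_candidates[OF assms(1)])

definition pair_count :: "'v set list \<Rightarrow> 'v \<Rightarrow> 'v \<Rightarrow> nat" where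
  "pair_count Ss u v = length (filter (\<lambda>S. u \<in> S \<and> v \<in> S) Ss)"

lemma length_filter_le_sum:
  assumes "finite A" "\<And>x. x \<in> set xs \<Longrightarrow> P x \<Longrightarrow> \<exists>a\<in>A. Q a x"
  shows "length (filter P xs) \<le> (\<Sum>a\<in>A. length (filter (Q a) xs))"
  using assms(2)
proof (induction xs)
  case (Cons x xs)
  have IH: "length (filter P xs) \<le> (\<Sum>a\<in>A. length (filter (Q a) xs))"
    using Cons by auto
  have "(\<Sum>a\<in>A. length (filter (Q a) (x # xs)))
      = (\<Sum>a\<in>A. length (filter (Q a) xs)) + (\<Sum>a\<in>A. if Q a x then 1 else 0)"
    by (subst sum.distrib[symmetric], intro sum.cong) auto
  moreover have "(if P x then 1 else 0) \<le> (\<Sum>a\<in>A. if Q a x then 1 else (0::nat))"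
  proof (cases "P x")
    case True
    then obtain a where "a \<in> A" "Q a x" using Cons.prems by auto
    then show ?thesis
      using member_le_sum[of a A "\<lambda>a. if Q a x then 1 else (0::nat)"] assms(1) by auto
  qed simp
  ultimately show ?case using IH by auto
qed simp

text \<open>A query in which \<open>u\<close> is not isolated contains a neighbour of \<open>u\<close>, and each neighbour can
  account for only few queries: observed non-isolation certifies a lower bound on the degree.\<close>

lemma nonisolated_count_le:
  assumes "finite W" "\<And>v. v \<in> W \<Longrightarrow> v \<noteq> u \<Longrightarrow> pair_count Ss u v \<le> l" "simple_graph V E"
  shows "nonisolated_count (answers E Ss W) u \<le> l * card (nbrs E W u)"
proof -
  have fin: "finite (nbrs E W u)" using assms(1) by (simp add: nbrs_def)
  have "nonisolated_count (answers E Ss W) u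
      = length (filter (\<lambda>S. u \<in> S \<inter> W \<and> {u} \<notin> cc_oracle E (S \<inter> W)) Ss)"
    by (rule nonisolated_count_answers)
  also have "\<dots> \<le> (\<Sum>v\<in>nbrs E W u. length (filter (\<lambda>S. u \<in> S \<and> v \<in> S) Ss))"
  proof (rule length_filter_le_sum[OF fin])
    fix S assume S: "u \<in> S \<inter> W \<and> {u} \<notin> cc_oracle E (S \<inter> W)"
    then have "nbrs E (S \<inter> W) u \<noteq> {}" using isolated_component by metis
    then show "\<exists>v\<in>nbrs E W u. u \<in> S \<and> v \<in> S" using S by (auto simp: nbrs_def)
  qed
  also have "\<dots> \<le> (\<Sum>v\<in>nbrs E W u. l)"
    using assms(2) self_notin_nbrs[OF assms(3)] nbrs_subset[of E W u]
    unfolding pair_count_def by (intro sum_mono) blast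
  finally show ?thesis by (simp add: mult.commute)
qed

text \<open>The counterpart by which certificates get issued: a neighbour of \<open>u\<close> in the
  same query shares the component of \<open>u\<close>.\<close>

lemma nonisolated_count_ge:
  assumes "simple_graph V E" "u \<in> W"
  shows "length (filter (\<lambda>S. u \<in> S \<and> nbrs E W u \<inter> S \<noteq> {}) Ss) \<le> nonisolated_count (answers E Ss W) u"
proof -
  have "{u} \<notin> cc_oracle E (S \<inter> W)" if "u \<in> S" "nbrs E W u \<inter> S \<noteq> {}" for S
  proof
    assume u: "{u} \<in> cc_oracle E (S \<inter> W)"
    from that obtain v where v: "v \<in> nbrs E W u" "v \<in> S" by auto
    then have "v \<in> {u}" using u edge_same_component[of u v E "S \<inter> W" "{u}"] by (auto simp: nbrs_def)
    then show False using v self_notin_nbrs[OF assms(1)] by auto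
  qed
  then have "length (filter (\<lambda>S. u \<in> S \<and> nbrs E W u \<inter> S \<noteq> {}) Ss)
      \<le> length (filter (\<lambda>S. u \<in> S \<inter> W \<and> {u} \<notin> cc_oracle E (S \<inter> W)) Ss)"
    using assms(2) by (induction Ss) auto
  then show ?thesis
    by (simp add: nonisolated_count_answers)
qed

section \<open>The peeling algorithm\<close>

text \<open>A non-adaptive batch inside the decision tree; the continuation sees all answers at
  once, in the order of the queries.\<close>

primrec ask :: "'v set list \<Rightarrow> ('v set set list \<Rightarrow> 'v cc_algorithm) \<Rightarrow> 'v cc_algorithm" where
  "ask [] k = k []"
| "ask (S # Ss) k = Query S (\<lambda>P. ask Ss (\<lambda>Ps. k (P # Ps)))"

lemma output_on_ask: "output_on (ask Ss k) E = output_on (k (map (cc_oracle E) Ss)) E"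
  by (induction Ss arbitrary: k) auto

lemma num_queries_on_ask:
  "num_queries_on (ask Ss k) E = length Ss + num_queries_on (k (map (cc_oracle E) Ss)) E"
  by (induction Ss arbitrary: k) auto

lemma queries_within_ask:
  "(\<And>S. S \<in> set Ss \<Longrightarrow> S \<subseteq> V) \<Longrightarrow> (\<And>Ps. queries_within V (k Ps)) \<Longrightarrow> queries_within V (ask Ss k)"
  by (induction Ss arbitrary: k) auto

text \<open>\<open>W\<close> is the set of vertices not yet peeled off, \<open>2 ^ i\<close> the current guess of the degeneracy and
  \<open>k\<close> is fuel.\<close>

primrec peel :: "(nat \<Rightarrow> 'v set list) \<Rightarrow> (nat \<Rightarrow> nat) \<Rightarrow> (nat \<Rightarrow> 'v set \<Rightarrow> 'v set set list \<Rightarrow> bool)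
    \<Rightarrow> nat \<Rightarrow> nat \<Rightarrow> 'v set \<Rightarrow> 'v edges \<Rightarrow> 'v cc_algorithm" where
  "peel fam tau cert 0 i W F = Output F"
| "peel fam tau cert (Suc k) i W F =
    (if W = {} then Output F
     else ask (map (\<lambda>S. S \<inter> W) (fam i)) (\<lambda>Ps.
       let L = low_vertices Ps W (tau i) in
       if card W \<le> 2 * card L
       then peel fam tau cert k i (W - L) (F \<union> {{u, v} | u v. u \<in> L \<and> v \<in> candidates Ps W u})
       else if cert i W Ps then peel fam tau cert k (Suc i) W F
       else Output F))"

lemma map_cc_oracle_answers: "map (cc_oracle E) (map (\<lambda>S. S \<inter> W) Ss) = answers E Ss W"
  by (simp add: answers_def)

lemma queries_within_peel:
  "W \<subseteq> V \<Longrightarrow> queries_within V (peel fam tau cert k i W F)"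
proof (induction k arbitrary: i W F)
  case (Suc k)
  have "queries_within V (peel fam tau cert k j (W - L) F')" for j L F'
    using Suc.prems by (intro Suc.IH) auto
  moreover have "queries_within V (peel fam tau cert k j W F')" for j F'
    using Suc.prems by (intro Suc.IH)
  ultimately show ?case
    using Suc.prems by (auto simp: Let_def split: if_split_asm intro!: queries_within_ask)
qed simp

section \<open>Correctness of the peeling\<close>

definition true_low :: "'v edges \<Rightarrow> nat \<Rightarrow> 'v set \<Rightarrow> 'v set" where
  "true_low E t W = {u \<in> W. card (nbrs E W u) \<le> t}"

text \<open>Refers to true, not observed, low degree, so that for given \<open>E\<close>,
  \<open>t\<close> and \<open>W\<close> it is an event about \<open>Ss\<close> alone.\<close>

definition exact_for :: "'v edges \<Rightarrow> 'v set list \<Rightarrow> nat \<Rightarrow> 'v set \<Rightarrow> bool" where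
  "exact_for E Ss t W \<longleftrightarrow> (\<forall>u\<in>true_low E t W. \<forall>v\<in>W. v \<noteq> u \<longrightarrow> v \<notin> nbrs E W u
     \<longrightarrow> isolating Ss u v (nbrs E W u))"

lemma exact_candidates:
  assumes "simple_graph V E" "exact_for E Ss t W" "u \<in> true_low E t W"
  shows "candidates (answers E Ss W) W u = nbrs E W u"
  using assms by (intro candidates_eq_nbrs[of V]) (auto simp: exact_for_def true_low_def)

text \<open>A vertex observed as low is low for any family, since candidates contain the neighbours;
  the converse uses exactness.\<close>

lemma exact_low_vertices:
  assumes "simple_graph V E" "exact_for E Ss t W" "finite W"
  shows "low_vertices (answers E Ss W) W t = true_low E t W"
proof (intro equalityI subsetI)
  fix u assume u: "u \<in> low_vertices (answers E Ss W) W t"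
  have "card (nbrs E W u) \<le> card (candidates (answers E Ss W) W u)"
    using assms(3) nbrs_subset_candidates[OF assms(1)]
    by (intro card_mono) (auto simp: candidates_def)
  then show "u \<in> true_low E t W"
    using u by (auto simp: low_vertices_def true_low_def)
next
  fix u assume u: "u \<in> true_low E t W"
  then show "u \<in> low_vertices (answers E Ss W) W t"
    using exact_candidates[OF assms(1,2) u] by (auto simp: low_vertices_def true_low_def)
qed

lemma many_high_of_few_low:
  assumes "finite W" "\<not> card W \<le> 2 * card (true_low E t W)"
  shows "W - true_low E t W \<noteq> {}" "card W \<le> 2 * card (W - true_low E t W)"
proof -
  have "card (W - true_low E t W) = card W - card (true_low E t W)"
    using assms(1) by (intro card_Diff_subset) (auto simp: true_low_def)
  then show *: "card W \<le> 2 * card (W - true_low E t W)" using assms(2) by simp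
  show "W - true_low E t W \<noteq> {}"
  proof
    assume "W - true_low E t W = {}"
    then have "card W \<le> 0" using * by (metis card.empty mult_0_right)
    then show False using assms(2) by simp
  qed
qed

text \<open>One round of \<open>peel\<close> when answers are exact and certificates granted. No
  family occurs in it, so the states are determined by the hidden graph.\<close>

definition ideal_step :: "'v edges \<Rightarrow> (nat \<Rightarrow> nat) \<Rightarrow> nat \<times> 'v set \<Rightarrow> nat \<times> 'v set" where
  "ideal_step E tau = (\<lambda>(i, W). let L = true_low E (tau i) W in
     if card W \<le> 2 * card L then (i, W - L) else (Suc i, W))"

lemma few_low_imp_less:
  assumes "simple_graph V E" "finite W" "\<not> card W \<le> 2 * card (true_low E t W)"
  shows "t < card W"
proof -
  obtain u where u: "u \<in> W" "u \<notin> true_low E t W"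
    using many_high_of_few_low(1)[OF assms(2,3)] by auto
  then have "t < card (nbrs E W u)" by (simp add: true_low_def)
  also have "\<dots> \<le> card W" using assms(2) nbrs_subset by (rule card_mono)
  finally show ?thesis .
qed

text \<open>\<open>X\<close> is a set of states closed under \<open>ideal_step\<close> on which the
  families behave well: all states in the deterministic case, one trajectory in the randomized case.
  \<open>F\<close> collects the edges that meet a peeled vertex. The fuel exceeds the potential
  \<open>card W + (card V - i)\<close>, which falls in every round.\<close>

lemma output_on_peel:
  assumes G: "simple_graph V E" "finite V"
    and tau: "\<And>i. i \<le> tau i"
    and X: "\<And>i W. (i, W) \<in> X \<Longrightarrow> W \<noteq> {} \<Longrightarrow> ideal_step E tau (i, W) \<in> X"
      "\<And>i W. (i, W) \<in> X \<Longrightarrow> W \<subseteq> V"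
      "\<And>i W. (i, W) \<in> X \<Longrightarrow> W \<noteq> {} \<Longrightarrow> exact_for E (fam i) (tau i) W"
      "\<And>i W. (i, W) \<in> X \<Longrightarrow> W \<noteq> {} \<Longrightarrow> \<not> card W \<le> 2 * card (true_low E (tau i) W)
        \<Longrightarrow> cert i W (answers E (fam i) W)"
    and "(i, W) \<in> X" "card W + (card V - i) < k" "F = {e \<in> E. \<not> e \<subseteq> W}"
  shows "output_on (peel fam tau cert k i W F) E = E"
  using assms(8-)
proof (induction k arbitrary: i W F)
  case (Suc k)
  show ?case
  proof (cases "W = {}")
    case True
    have "{} \<notin> E" using simple_graph_edgeE[OF G(1)] by blast
    then have "e \<noteq> {}" if "e \<in> E" for e using that by metis
    then have "F = E" using True Suc.prems(3) by auto
    then show ?thesis using True by simp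
  next
    case W: False
    have fin: "finite W" using X(2)[OF Suc.prems(1)] G(2) finite_subset by blast
    define L where "L = true_low E (tau i) W"
    have exact: "exact_for E (fam i) (tau i) W" using X(3) Suc.prems(1) W .
    have low: "low_vertices (answers E (fam i) W) W (tau i) = L"
      unfolding L_def using G(1) exact fin by (rule exact_low_vertices)
    have L: "L \<subseteq> W" by (auto simp: L_def true_low_def)
    show ?thesis
    proof (cases "card W \<le> 2 * card L")
      case True
      define F' where
        "F' = F \<union> {{u, v} | u v. u \<in> L \<and> v \<in> candidates (answers E (fam i) W) W u}"
      have "ideal_step E tau (i, W) = (i, W - L)"
        using True by (simp add: ideal_step_def L_def)
      then have inX: "(i, W - L) \<in> X" using X(1)[OF Suc.prems(1) W] by simp
      have "0 < card W" using W fin by (simp add: card_gt_0_iff)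
      then have "0 < card L" using True by simp
      then have "card (W - L) < card W"
        using \<open>0 < card W\<close> L fin by (simp add: card_Diff_subset finite_subset)
      then have fuel: "card (W - L) + (card V - i) < k" using Suc.prems(2) by simp
      have "{{u, v} | u v. u \<in> L \<and> v \<in> candidates (answers E (fam i) W) W u}
          = {{u, v} | u v. u \<in> L \<and> v \<in> nbrs E W u}"
        using exact_candidates[OF G(1) exact] unfolding L_def by blast
      also have "\<dots> = {e \<in> E. e \<subseteq> W \<and> \<not> e \<subseteq> W - L}"
      proof (intro equalityI subsetI)
        fix e assume e: "e \<in> {e \<in> E. e \<subseteq> W \<and> \<not> e \<subseteq> W - L}"
        then have "e \<in> E" by simp
        then obtain u v where uv: "e = {u, v}" by (rule simple_graph_edgeE[OF G(1)])
        show "e \<in> {{u, v} | u v. u \<in> L \<and> v \<in> nbrs E W u}"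
        proof (cases "u \<in> L")
          case True
          then show ?thesis using e uv by (auto simp: nbrs_def)
        next
          case False
          then have "v \<in> L" "e = {v, u}" "u \<in> nbrs E W v"
            using e uv by (auto simp: nbrs_def insert_commute)
          then show ?thesis by blast
        qed
      qed (use L in \<open>auto simp: nbrs_def\<close>)
      finally have "F' = {e \<in> E. \<not> e \<subseteq> W - L}"
        unfolding F'_def using Suc.prems(3) by auto
      then have "output_on (peel fam tau cert k i (W - L) F') E = E"
        using Suc.IH[OF inX fuel] by simp
      then show ?thesis
        using W True unfolding F'_def
        by (simp add: output_on_ask map_cc_oracle_answers low Let_def del: map_map)
    next
      case False
      then have "cert i W (answers E (fam i) W)" using X(4) Suc.prems(1) W by (simp add: L_def)
      moreover have "ideal_step E tau (i, W) = (Suc i, W)"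
        using False by (simp add: ideal_step_def L_def)
      then have inX: "(Suc i, W) \<in> X" using X(1)[OF Suc.prems(1) W] by simp
      \<comment> \<open>As \<open>i \<le> tau i < card W \<le> card V\<close>, raising the guess
        really lowers the truncated difference \<open>card V - i\<close>.\<close>
      have "tau i < card W" using few_low_imp_less[OF G(1) fin] False by (simp add: L_def)
      moreover have "card W \<le> card V" using X(2)[OF Suc.prems(1)] G(2) by (rule card_mono[rotated])
      ultimately have "card W + (card V - Suc i) < k"
        using tau[of i] Suc.prems(2) by linarith
      then have "output_on (peel fam tau cert k (Suc i) W F) E = E"
        using Suc.IH[OF inX] Suc.prems(3) by simp
      then show ?thesis
        using W False \<open>cert i W (answers E (fam i) W)\<close>
        by (simp add: output_on_ask map_cc_oracle_answers low Let_def del: map_map)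
    qed
  qed
qed simp

section \<open>Number of queries of the peeling\<close>

lemma floorlog_halve:
  assumes "0 < a" "2 * b \<le> a"
  shows "Suc (floorlog 2 b) \<le> floorlog 2 a"
proof -
  have "floorlog 2 a = floorlog 2 (a div 2) + 1"
    using assms(1) by (subst compute_floorlog) simp
  moreover have "b \<le> a div 2" using assms(2) by simp
  ultimately show ?thesis using floorlog_mono[of b "a div 2" 2] by simp
qed

text \<open>A peeling round at least halves \<open>W\<close>, so at most
  \<open>floorlog 2 (card W)\<close> of them occur at guess \<open>i\<close>; a raised guess costs
  one more batch and restarts the count, charged with \<open>card V\<close>. Exactness is not
  assumed, so unlucky families are covered too.\<close>

lemma num_queries_on_peel_aux:
  assumes "finite V"
    and inc: "\<And>i W. W \<subseteq> V \<Longrightarrow> W \<noteq> {} \<Longrightarrow>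
      \<not> card W \<le> 2 * card (low_vertices (answers E (fam i) W) W (tau i)) \<Longrightarrow>
      cert i W (answers E (fam i) W) \<Longrightarrow> i < M"
    and "W \<subseteq> V"
  shows "num_queries_on (peel fam tau cert k i W F) E \<le> floorlog 2 (card W) * length (fam i)
    + (\<Sum>j\<in>{i..<M}. length (fam j) + floorlog 2 (card V) * length (fam (Suc j)))"
  using assms(3)
proof (induction k arbitrary: i W F)
  case (Suc k)
  let ?R = "\<lambda>i. \<Sum>j\<in>{i..<M}. length (fam j) + floorlog 2 (card V) * length (fam (Suc j))"
  show ?case
  proof (cases "W = {}")
    case False
    have fin: "finite W" using Suc.prems assms(1) finite_subset by blast
    have pos: "0 < card W" using False fin by (simp add: card_gt_0_iff)
    define Ps where "Ps = answers E (fam i) W"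
    define L where "L = low_vertices Ps W (tau i)"
    have L: "L \<subseteq> W" by (auto simp: L_def low_vertices_def)
    consider "card W \<le> 2 * card L" | "\<not> card W \<le> 2 * card L" "cert i W Ps"
      | "\<not> card W \<le> 2 * card L" "\<not> cert i W Ps" by blast
    then show ?thesis
    proof cases
      case 1
      define F' where "F' = F \<union> {{u, v} | u v. u \<in> L \<and> v \<in> candidates Ps W u}"
      have "card (W - L) = card W - card L"
        using L fin by (simp add: card_Diff_subset finite_subset)
      then have "Suc (floorlog 2 (card (W - L))) \<le> floorlog 2 (card W)"
        using pos 1 by (intro floorlog_halve) auto
      then have *: "Suc (floorlog 2 (card (W - L))) * length (fam i) \<le> floorlog 2 (card W) * length (fam i)"
        by (rule mult_right_mono) simp
      have "num_queries_on (peel fam tau cert k i (W - L) F') E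
          \<le> floorlog 2 (card (W - L)) * length (fam i) + ?R i"
        using Suc.prems by (intro Suc.IH) auto
      moreover have "num_queries_on (peel fam tau cert (Suc k) i W F) E
          = length (fam i) + num_queries_on (peel fam tau cert k i (W - L) F') E"
        using False 1
        by (simp add: num_queries_on_ask map_cc_oracle_answers Let_def Ps_def L_def F'_def del: map_map)
      ultimately show ?thesis using * by simp
    next
      \<comment> \<open>The summand for \<open>j = i\<close> pays for the failed batch and for all
        peeling at guess \<open>Suc i\<close>.\<close>
      case 2
      then have "i < M" using inc Suc.prems False unfolding L_def Ps_def by blast
      then have R: "?R i = length (fam i) + floorlog 2 (card V) * length (fam (Suc i)) + ?R (Suc i)"
        by (simp add: sum.atLeast_Suc_lessThan)
      have "floorlog 2 (card W) \<le> floorlog 2 (card V)"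
        using Suc.prems assms(1) by (intro floorlog_mono card_mono)
      then have *: "floorlog 2 (card W) * length (fam (Suc i)) \<le> floorlog 2 (card V) * length (fam (Suc i))"
        by (rule mult_right_mono) simp
      have "num_queries_on (peel fam tau cert k (Suc i) W F) E
          \<le> floorlog 2 (card W) * length (fam (Suc i)) + ?R (Suc i)"
        by (rule Suc.IH) fact
      moreover have "num_queries_on (peel fam tau cert (Suc k) i W F) E
          = length (fam i) + num_queries_on (peel fam tau cert k (Suc i) W F) E"
        using False 2
        by (simp add: num_queries_on_ask map_cc_oracle_answers Let_def Ps_def L_def del: map_map)
      ultimately show ?thesis using * R by linarith
    next
      \<comment> \<open>Giving up ends the run after this batch, which the first summand covers
        because \<open>floorlog\<close> is at least 1 for nonempty \<open>W\<close>.\<close>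
      case 3
      then have "num_queries_on (peel fam tau cert (Suc k) i W F) E = length (fam i)"
        using False
        by (simp add: num_queries_on_ask map_cc_oracle_answers Let_def Ps_def L_def del: map_map)
      moreover have "1 \<le> floorlog 2 (card W)"
        using pos floorlog_eq_zero_iff[of 2 "card W"] by linarith
      then have "1 * length (fam i) \<le> floorlog 2 (card W) * length (fam i)"
        by (rule mult_right_mono) simp
      ultimately show ?thesis by linarith
    qed
  qed simp
qed simp

lemma num_queries_on_peel:
  assumes "finite V"
    and "\<And>i W. W \<subseteq> V \<Longrightarrow> W \<noteq> {} \<Longrightarrow>
      \<not> card W \<le> 2 * card (low_vertices (answers E (fam i) W) W (tau i)) \<Longrightarrow>
      cert i W (answers E (fam i) W) \<Longrightarrow> i < M"
  shows "num_queries_on (peel fam tau cert k 0 V F) E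
    \<le> (floorlog 2 (card V) + 1) * (\<Sum>j\<le>M. length (fam j))"
proof -
  let ?l = "floorlog 2 (card V)"
  have "num_queries_on (peel fam tau cert k 0 V F) E \<le> ?l * length (fam 0)
    + (\<Sum>j\<in>{0..<M}. length (fam j) + ?l * length (fam (Suc j)))"
    by (rule num_queries_on_peel_aux) (use assms in auto)
  also have "\<dots> = (\<Sum>j<M. length (fam j)) + ?l * (length (fam 0) + (\<Sum>j<M. length (fam (Suc j))))"
    by (simp add: sum.distrib sum_distrib_left atLeast0LessThan algebra_simps)
  also have "length (fam 0) + (\<Sum>j<M. length (fam (Suc j))) = (\<Sum>j\<le>M. length (fam j))"
    by (simp add: sum.atMost_shift)
  also have "(\<Sum>j<M. length (fam j)) \<le> (\<Sum>j\<le>M. length (fam j))"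
    by (intro sum_mono2) auto
  finally show ?thesis by simp
qed

section \<open>Random families of vertex sets\<close>

definition random_set :: "'v set \<Rightarrow> real \<Rightarrow> 'v set pmf" where
  "random_set V p = map_pmf (\<lambda>f. {v \<in> V. f v}) (Pi_pmf V False (\<lambda>_. bernoulli_pmf p))"

lemma prob_random_set:
  assumes "finite V" "A \<subseteq> V" "B \<subseteq> V" "A \<inter> B = {}" "0 \<le> p" "p \<le> 1"
  shows "measure_pmf.prob (random_set V p) {S. A \<subseteq> S \<and> B \<inter> S = {}} = p ^ card A * (1 - p) ^ card B"
proof -
  have fin: "finite A" "finite B" using assms finite_subset by blast+
  let ?C = "\<lambda>v. if v \<in> A then {True} else if v \<in> B then {False} else UNIV"
  have "(\<lambda>f. {v \<in> V. f v}) -` {S. A \<subseteq> S \<and> B \<inter> S = {}} = Pi V ?C"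
    using assms(2-4) by (auto simp: Pi_def split: if_splits)
  then have "measure_pmf.prob (random_set V p) {S. A \<subseteq> S \<and> B \<inter> S = {}}
      = (\<Prod>v\<in>V. measure_pmf.prob (bernoulli_pmf p) (?C v))"
    unfolding random_set_def measure_map_pmf by (simp only: measure_Pi_pmf_Pi[OF assms(1)])
  also have "\<dots> = (\<Prod>v\<in>V. (if v \<in> A then p else 1) * (if v \<in> B then 1 - p else 1))"
    using assms(4-6) by (intro prod.cong) (auto simp: measure_pmf_single)
  also have "\<dots> = p ^ card A * (1 - p) ^ card B"
    using assms(1-3) fin by (simp add: prod.distrib prod.If_cases Int_absorb1)
  finally show ?thesis .
qed

text \<open>The generating function of a binomial count: each independent draw contributes the
  factor \<open>z\<close> if it is a hit and 1 otherwise.\<close>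

lemma nn_integral_replicate_pmf_power:
  assumes "0 \<le> z"
  shows "(\<integral>\<^sup>+ xs. ennreal (z ^ length (filter Q xs)) \<partial>measure_pmf (replicate_pmf t M))
    = ennreal ((1 - measure_pmf.prob M {x. Q x} + z * measure_pmf.prob M {x. Q x}) ^ t)"
proof (induction t)
  case (Suc t)
  let ?q = "measure_pmf.prob M {x. Q x}"
  let ?I = "\<integral>\<^sup>+ xs. ennreal (z ^ length (filter Q xs)) \<partial>measure_pmf (replicate_pmf t M)"
  have q: "0 \<le> ?q" "?q \<le> 1" by auto
  have neg: "measure_pmf.prob M {x. \<not> Q x} = 1 - ?q"
    using measure_pmf.prob_compl[of "{x. Q x}" M] by (simp add: Compl_eq_Diff_UNIV[symmetric] Collect_neg_eq)
  have "(\<integral>\<^sup>+ xs. ennreal (z ^ length (filter Q xs)) \<partial>measure_pmf (replicate_pmf (Suc t) M))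
      = (\<integral>\<^sup>+ x. (\<integral>\<^sup>+ xs. ennreal (z ^ length (filter Q (x # xs))) \<partial>measure_pmf (replicate_pmf t M)) \<partial>measure_pmf M)"
    by (simp add: nn_integral_bind_pmf)
  also have "\<dots> = (\<integral>\<^sup>+ x. (ennreal z * indicator {x. Q x} x + indicator {x. \<not> Q x} x) * ?I \<partial>measure_pmf M)"
  proof (intro nn_integral_cong)
    fix x
    show "(\<integral>\<^sup>+ xs. ennreal (z ^ length (filter Q (x # xs))) \<partial>measure_pmf (replicate_pmf t M))
        = (ennreal z * indicator {x. Q x} x + indicator {x. \<not> Q x} x) * ?I"
      using assms by (cases "Q x") (simp_all add: ennreal_mult nn_integral_cmult)
  qed
  also have "\<dots> = (ennreal z * emeasure M {x. Q x} + emeasure M {x. \<not> Q x}) * ?I"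
    by (simp add: nn_integral_multc nn_integral_add nn_integral_cmult)
  also have "\<dots> = ennreal (z * ?q + (1 - ?q)) * ?I"
    using assms q by (simp add: measure_pmf.emeasure_eq_measure neg ennreal_mult ennreal_plus)
  also have "\<dots> = ennreal ((z * ?q + (1 - ?q)) * (1 - ?q + z * ?q) ^ t)"
    using assms q by (simp add: Suc.IH ennreal_mult)
  finally show ?case by (simp add: add.commute)
qed simp

text \<open>Markov's inequality for \<open>z\<close> to the number of hits. The three tail bounds
  below take \<open>z = 0\<close>, \<open>z = 2\<close> and \<open>z = 1/2\<close>.\<close>

lemma prob_replicate_pmf_le:
  assumes "0 \<le> z" "0 \<le> c" "\<And>xs. xs \<in> X \<Longrightarrow> 1 \<le> c * z ^ length (filter Q xs)"
  shows "measure_pmf.prob (replicate_pmf t M) X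
    \<le> c * (1 - measure_pmf.prob M {x. Q x} + z * measure_pmf.prob M {x. Q x}) ^ t"
proof -
  let ?q = "measure_pmf.prob M {x. Q x}" and ?N = "replicate_pmf t M"
  have q: "0 \<le> ?q" "?q \<le> 1" by auto
  have "emeasure ?N X = (\<integral>\<^sup>+ xs. indicator X xs \<partial>?N)" by simp
  also have "\<dots> \<le> (\<integral>\<^sup>+ xs. ennreal c * ennreal (z ^ length (filter Q xs)) \<partial>?N)"
    using assms by (intro nn_integral_mono)
      (auto simp: indicator_def simp flip: ennreal_mult ennreal_1 intro!: ennreal_leI)
  also have "\<dots> = ennreal (c * (1 - ?q + z * ?q) ^ t)"
    using assms q
    by (simp add: nn_integral_cmult nn_integral_replicate_pmf_power ennreal_mult)
  finally show ?thesis
    using assms q by (simp add: measure_pmf.emeasure_eq_measure)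
qed

lemma power_le_exp: "- 1 \<le> x \<Longrightarrow> (1 + x) ^ t \<le> exp (x * real t)" for x :: real
proof -
  assume "- 1 \<le> x"
  then have "(1 + x) ^ t \<le> exp x ^ t" by (intro power_mono exp_ge_add_one_self) auto
  then show ?thesis by (simp add: exp_of_nat_mult[symmetric] mult.commute)
qed

lemma prob_replicate_none:
  assumes "q \<le> measure_pmf.prob M {x. Q x}"
  shows "measure_pmf.prob (replicate_pmf t M) {xs. \<forall>x\<in>set xs. \<not> Q x} \<le> exp (- (q * real t))"
proof -
  let ?q = "measure_pmf.prob M {x. Q x}"
  \<comment> \<open>With \<open>z = 0\<close> and \<open>0 ^ 0 = 1\<close> the power is the
    indicator of no hit.\<close>
  have "measure_pmf.prob (replicate_pmf t M) {xs. \<forall>x\<in>set xs. \<not> Q x} \<le> 1 * (1 - ?q + 0 * ?q) ^ t"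
    by (rule prob_replicate_pmf_le) (auto simp: filter_empty_conv)
  also have "\<dots> \<le> exp (- ?q * real t)"
    using power_le_exp[of "- ?q" t] by simp
  also have "\<dots> \<le> exp (- (q * real t))"
    using assms by (simp add: mult_right_mono)
  finally show ?thesis .
qed

lemma prob_replicate_many:
  assumes "measure_pmf.prob M {x. Q x} \<le> q"
  shows "measure_pmf.prob (replicate_pmf t M) {xs. k \<le> length (filter Q xs)} \<le> exp (q * real t) / 2 ^ k"
proof -
  let ?q = "measure_pmf.prob M {x. Q x}"
  have "measure_pmf.prob (replicate_pmf t M) {xs. k \<le> length (filter Q xs)}
      \<le> 1 / 2 ^ k * (1 - ?q + 2 * ?q) ^ t"
  proof (rule prob_replicate_pmf_le)
    fix xs assume "xs \<in> {xs. k \<le> length (filter Q xs)}"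
    then have "(2::real) ^ k \<le> 2 ^ length (filter Q xs)" by (intro power_increasing) auto
    then show "1 \<le> 1 / 2 ^ k * (2::real) ^ length (filter Q xs)" by simp
  qed auto
  also have "\<dots> \<le> 1 / 2 ^ k * exp (?q * real t)"
    using power_le_exp[of ?q t] measure_nonneg[of M "{x. Q x}"]
    by (intro mult_left_mono) (auto simp: add.commute)
  also have "\<dots> \<le> 1 / 2 ^ k * exp (q * real t)"
    using assms by (intro mult_left_mono) (auto simp: mult_right_mono)
  finally show ?thesis by simp
qed

lemma prob_replicate_few:
  assumes "q \<le> measure_pmf.prob M {x. Q x}"
  shows "measure_pmf.prob (replicate_pmf t M) {xs. length (filter Q xs) \<le> k}
    \<le> 2 ^ k * exp (- (q * real t / 2))"
proof -
  let ?q = "measure_pmf.prob M {x. Q x}"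
  have "measure_pmf.prob (replicate_pmf t M) {xs. length (filter Q xs) \<le> k}
      \<le> 2 ^ k * (1 - ?q + 1/2 * ?q) ^ t"
  proof (rule prob_replicate_pmf_le)
    fix xs assume "xs \<in> {xs. length (filter Q xs) \<le> k}"
    then have "(2::real) ^ length (filter Q xs) \<le> 2 ^ k" by (intro power_increasing) auto
    then show "1 \<le> 2 ^ k * (1/2::real) ^ length (filter Q xs)" by (simp add: power_divide)
  qed auto
  also have "1 - ?q + 1/2 * ?q = 1 + - ?q / 2" by simp
  also have "2 ^ k * (1 + - ?q / 2) ^ t \<le> 2 ^ k * exp (- ?q / 2 * real t)"
    by (intro mult_left_mono power_le_exp)
      (auto intro: order.trans[OF measure_pmf.prob_le_1[of M "{x. Q x}"]])
  also have "\<dots> \<le> 2 ^ k * exp (- (q * real t / 2))"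
    using assms by (intro mult_left_mono) (auto simp: mult_right_mono)
  finally show ?thesis .
qed

lemma prob_UN_le:
  fixes M :: "'a pmf"
  assumes "finite I" "\<And>i. i \<in> I \<Longrightarrow> measure_pmf.prob M (B i) \<le> e" "X \<subseteq> (\<Union>i\<in>I. B i)"
  shows "measure_pmf.prob M X \<le> real (card I) * e"
proof -
  have "measure_pmf.prob M X \<le> measure_pmf.prob M (\<Union>i\<in>I. B i)"
    by (intro measure_pmf.finite_measure_mono assms(3)) simp
  also have "\<dots> \<le> (\<Sum>i\<in>I. measure_pmf.prob M (B i))"
    by (intro measure_pmf.finite_measure_subadditive_finite assms(1)) auto
  also have "\<dots> \<le> real (card I) * e"
    using assms(2) by (rule sum_bounded_above)
  finally show ?thesis .
qed

section \<open>Isolation, pair counts and hits in a random family\<close>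

lemma one_minus_inverse_power_ge:
  fixes s :: nat
  assumes "0 < s" "m \<le> 2 * s"
  shows "1 / 4 \<le> (1 - 1 / real (2 * s)) ^ m"
proof -
  let ?x = "1 / real (2 * s)"
  have x: "0 \<le> 1 - ?x" "1 - ?x \<le> 1" using assms(1) by auto
  \<comment> \<open>Bernoulli's inequality gives 1/2 for the exponent \<open>s\<close>; squaring
    reaches \<open>2 * s\<close>.\<close>
  have "1 / 2 = 1 + real s * (- ?x)" using assms(1) by simp
  also have "\<dots> \<le> (1 + - ?x) ^ s" using x by (intro Bernoulli_inequality) auto
  finally have "(1 / 2) ^ 2 \<le> ((1 - ?x) ^ s) ^ 2" by (intro power_mono) auto
  also have "\<dots> = (1 - ?x) ^ (2 * s)" by (simp add: power_mult[symmetric] mult.commute)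
  also have "\<dots> \<le> (1 - ?x) ^ m" using x assms(2) by (intro power_decreasing) auto
  finally show ?thesis by (simp add: power2_eq_square)
qed

text \<open>With \<open>p = 1 / (2 * s)\<close> one set isolates with probability
  \<open>p ^ 2 * (1 - p) ^ card N\<close>, and the second factor is at least 1/4.\<close>

lemma prob_not_isolating_le:
  assumes "finite V" "u \<in> V" "v \<in> V" "u \<noteq> v" "N \<subseteq> V - {u, v}" "card N \<le> 2 * s" "0 < s"
  shows "measure_pmf.prob (replicate_pmf t (random_set V (1 / real (2 * s)))) {Ss. \<not> isolating Ss u v N}
    \<le> exp (- ((1 / (16 * real s ^ 2)) * real t))"
proof -
  let ?p = "1 / real (2 * s)"
  let ?Q = "\<lambda>S. {u, v} \<subseteq> S \<and> N \<inter> S = {}"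
  have "measure_pmf.prob (random_set V ?p) {S. ?Q S} = ?p ^ card {u, v} * (1 - ?p) ^ card N"
    using assms by (intro prob_random_set) auto
  moreover have "?p ^ card {u, v} = 1 / (4 * real s ^ 2)"
    using assms(4) by (simp add: power2_eq_square)
  moreover have "1 / 4 \<le> (1 - ?p) ^ card N"
    using assms by (intro one_minus_inverse_power_ge) auto
  then have "1 / (4 * real s ^ 2) * (1 / 4) \<le> 1 / (4 * real s ^ 2) * (1 - ?p) ^ card N"
    by (rule mult_left_mono) simp
  ultimately have "1 / (16 * real s ^ 2) \<le> measure_pmf.prob (random_set V ?p) {S. ?Q S}" by simp
  then have "measure_pmf.prob (replicate_pmf t (random_set V ?p)) {Ss. \<forall>S\<in>set Ss. \<not> ?Q S}
      \<le> exp (- ((1 / (16 * real s ^ 2)) * real t))"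
    by (rule prob_replicate_none)
  moreover have "{Ss. \<not> isolating Ss u v N} = {Ss. \<forall>S\<in>set Ss. \<not> ?Q S}"
    by (auto simp: isolating_def)
  ultimately show ?thesis by simp
qed

text \<open>A set contains both vertices with probability \<open>1 / (4 * s ^ 2)\<close>, so the
  numerator is the exponential of the expected count.\<close>

lemma prob_pair_count_ge_le:
  assumes "finite V" "u \<in> V" "v \<in> V" "u \<noteq> v" "0 < s"
  shows "measure_pmf.prob (replicate_pmf t (random_set V (1 / real (2 * s)))) {Ss. k \<le> pair_count Ss u v}
    \<le> exp ((1 / (4 * real s ^ 2)) * real t) / 2 ^ k"
proof -
  let ?p = "1 / real (2 * s)"
  have "measure_pmf.prob (random_set V ?p) {S. {u, v} \<subseteq> S \<and> {} \<inter> S = {}} = ?p ^ card {u, v} * (1 - ?p) ^ card ({} :: 'a set)"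
    using assms by (intro prob_random_set) auto
  also have "\<dots> = 1 / (4 * real s ^ 2)"
    using assms(4) by (simp add: power2_eq_square)
  finally have "measure_pmf.prob (random_set V ?p) {S. u \<in> S \<and> v \<in> S} \<le> 1 / (4 * real s ^ 2)"
    by simp
  then show ?thesis
    unfolding pair_count_def by (rule prob_replicate_many)
qed

text \<open>The mean number of hits is at least \<open>t / (4 * s)\<close>: \<open>u\<close> is
  drawn with probability \<open>1 / (2 * s)\<close>, and \<open>N\<close> is missed with probability
  at most \<open>1 / e\<close>, hence at most 1/2.\<close>

lemma prob_few_hits_le:
  assumes "finite V" "u \<in> V" "N \<subseteq> V - {u}" "2 * s \<le> card N" "0 < s"
  shows "measure_pmf.prob (replicate_pmf t (random_set V (1 / real (2 * s))))
      {Ss. length (filter (\<lambda>S. u \<in> S \<and> N \<inter> S \<noteq> {}) Ss) \<le> k}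
    \<le> 2 ^ k * exp (- ((1 / (4 * real s)) * real t / 2))"
proof (rule prob_replicate_few)
  let ?p = "1 / real (2 * s)" and ?M = "random_set V (1 / real (2 * s))"
  have p: "0 \<le> ?p" "?p \<le> 1" using assms(5) by auto
  have 1: "measure_pmf.prob ?M {S. {u} \<subseteq> S \<and> {} \<inter> S = {}} = ?p ^ card {u} * (1 - ?p) ^ card ({} :: 'a set)"
    using assms p by (intro prob_random_set) auto
  have 2: "measure_pmf.prob ?M {S. {u} \<subseteq> S \<and> N \<inter> S = {}} = ?p ^ card {u} * (1 - ?p) ^ card N"
    using assms p by (intro prob_random_set) auto
  have "(1 - ?p) ^ card N \<le> (1 - ?p) ^ (2 * s)"
    using assms(4) p by (intro power_decreasing) auto
  also have "\<dots> \<le> exp (- ?p * real (2 * s))"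
    using power_le_exp[of "- ?p" "2 * s"] p by simp
  also have "\<dots> = exp (- 1)" using assms(5) by simp
  also have "\<dots> \<le> 1 / 2" using exp_ge_add_one_self[of 1] by (simp add: exp_minus field_simps)
  finally have 3: "(1 - ?p) ^ card N \<le> 1 / 2" .
  have "{S. u \<in> S \<and> N \<inter> S \<noteq> {}} = {S. {u} \<subseteq> S \<and> {} \<inter> S = {}} - {S. {u} \<subseteq> S \<and> N \<inter> S = {}}"
    by auto
  then have "measure_pmf.prob ?M {S. u \<in> S \<and> N \<inter> S \<noteq> {}}
      = measure_pmf.prob ?M {S. {u} \<subseteq> S \<and> {} \<inter> S = {}} - measure_pmf.prob ?M {S. {u} \<subseteq> S \<and> N \<inter> S = {}}"
    by (simp only:) (rule measure_pmf.finite_measure_Diff, auto)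
  also have "\<dots> = ?p * (1 - (1 - ?p) ^ card N)"
    unfolding 1 2 by (simp add: right_diff_distrib)
  also have "\<dots> \<ge> ?p * (1 / 2)"
    using 3 p by (intro mult_left_mono) auto
  finally show "1 / (4 * real s) \<le> measure_pmf.prob ?M {S. u \<in> S \<and> N \<inter> S \<noteq> {}}" by simp
qed

section \<open>The deterministic algorithm\<close>

text \<open>An integer of order \<open>ln n\<close> whose exponential is at least \<open>n\<close>;
  the summand 1 keeps it positive for \<open>n \<le> 1\<close>.\<close>

definition log_size :: "nat \<Rightarrow> nat" where
  "log_size n = nat \<lceil>ln (real n)\<rceil> + 1"

lemma real_le_exp_log_size: "real n \<le> exp (real (log_size n))"
proof (cases "n = 0")
  case False
  have "ln (real n) \<le> real (log_size n)" unfolding log_size_def by linarith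
  then have "exp (ln (real n)) \<le> exp (real (log_size n))" by simp
  then show ?thesis using False by simp
qed simp

lemma ln_ge_two_thirds: "2 \<le> n \<Longrightarrow> 2 / 3 \<le> ln (real n)"
proof -
  assume "2 \<le> n"
  then have "ln 2 \<le> ln (real n)" by simp
  then show ?thesis using ln2_ge_two_thirds by linarith
qed

lemma log_size_le: "2 \<le> n \<Longrightarrow> real (log_size n) \<le> 4 * ln (real n)"
  using ln_ge_two_thirds[of n] unfolding log_size_def by linarith

lemma floorlog_le_ln:
  assumes "2 \<le> n"
  shows "real (floorlog 2 n + 1) \<le> 5 * ln (real n)"
proof -
  have l: "log 2 (real n) \<le> 3 / 2 * ln (real n)"
  proof -
    have "ln (real n) * 1 \<le> ln (real n) * (3 / 2 * ln 2)"
      using ln2_ge_two_thirds assms by (intro mult_left_mono) auto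
    then show ?thesis by (simp add: log_def divide_simps)
  qed
  have "0 \<le> log 2 (real n)" using assms by simp
  then have "real (floorlog 2 n + 1) \<le> log 2 (real n) + 2"
    using assms unfolding floorlog_def by simp
  then show ?thesis using l ln_ge_two_thirds[OF assms] by linarith
qed

text \<open>Costs growing geometrically with the guess are dominated by the last one, so doubling
  loses only a constant factor.\<close>

lemma sum_power_le: "2 \<le> b \<Longrightarrow> (\<Sum>j\<le>m. b ^ j) \<le> 2 * b ^ m" for b :: nat
proof (induction m)
  case (Suc m)
  have "2 * b ^ m \<le> b * b ^ m" using Suc.prems by (rule mult_right_mono) simp
  moreover have "(\<Sum>j\<le>Suc m. b ^ j) = (\<Sum>j\<le>m. b ^ j) + b * b ^ m" by simp
  moreover have "(\<Sum>j\<le>m. b ^ j) \<le> 2 * b ^ m" using Suc by simp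
  ultimately show ?case unfolding power_Suc by linarith
qed simp

section \<open>Universal families by the probabilistic method\<close>

definition universal_family :: "'v set \<Rightarrow> nat \<Rightarrow> 'v set list \<Rightarrow> bool" where
  "universal_family V t Ss \<longleftrightarrow> (\<forall>u\<in>V. \<forall>v\<in>V. \<forall>N. u \<noteq> v \<longrightarrow> N \<subseteq> V - {u, v} \<longrightarrow> card N \<le> t
     \<longrightarrow> isolating Ss u v N)"

text \<open>Union bound over \<open>u\<close>, \<open>v\<close> and \<open>N\<close>: there are
  about \<open>n ^ (2 * s + 2)\<close> choices, so each may fail only with probability exponentially
  small in \<open>s * log n\<close>. Hence the cube of \<open>s\<close>, where a single
  neighbourhood needs the square.\<close>

lemma universal_family_exists:
  fixes V :: "'v set"
  assumes V: "finite V" and s: "0 < s"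
  shows "\<exists>Ss. length Ss = 128 * s ^ 3 * log_size (card V) \<and> universal_family V (2 * s) Ss"
proof -
  define l where "l = log_size (card V)"
  define t where "t = 128 * s ^ 3 * l"
  define M where "M = replicate_pmf t (random_set V (1 / real (2 * s)))"
  \<comment> \<open>Sets \<open>N\<close> of size at most \<open>2 * s\<close> are enumerated by
    lists of length exactly \<open>2 * s\<close>, whose number is a plain power of
    \<open>card V\<close>.\<close>
  let ?lists = "{xs. set xs \<subseteq> V \<and> length xs = 2 * s}"
  let ?I = "V \<times> V \<times> ?lists"
  let ?B = "\<lambda>(u, v, xs). if u = v then {} else {Ss. \<not> isolating Ss u v (set xs - {u, v})}"
  have "measure_pmf.prob M {Ss. \<not> universal_family V (2 * s) Ss} \<le> real (card ?I) * exp (- (8 * real s * real l))"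
  proof (rule prob_UN_le)
    show "finite ?I" using V by (auto intro: finite_lists_length_eq)
  next
    fix i assume "i \<in> ?I"
    then obtain u v xs where i: "i = (u, v, xs)" "u \<in> V" "v \<in> V" "set xs \<subseteq> V" "length xs = 2 * s"
      by auto
    show "measure_pmf.prob M (?B i) \<le> exp (- (8 * real s * real l))"
    proof (cases "u = v")
      case False
      have "card (set xs - {u, v}) \<le> 2 * s"
        using card_Diff_subset_Int[of "set xs" "{u, v}"] card_length[of xs] i
        by (metis List.finite_set card_Diff1_le card_mono Diff_subset order.trans)
      then have "measure_pmf.prob M {Ss. \<not> isolating Ss u v (set xs - {u, v})}
          \<le> exp (- ((1 / (16 * real s ^ 2)) * real t))"
        unfolding M_def using False i s V by (intro prob_not_isolating_le) auto
      also have "(1 / (16 * real s ^ 2)) * real t = 8 * real s * real l"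
        using s by (simp add: t_def power2_eq_square power3_eq_cube)
      finally show ?thesis using False i by simp
    qed (use i in simp)
  next
    show "{Ss. \<not> universal_family V (2 * s) Ss} \<subseteq> (\<Union>i\<in>?I. ?B i)"
    proof
      fix Ss assume "Ss \<in> {Ss. \<not> universal_family V (2 * s) Ss}"
      then obtain u v N where uvN: "u \<in> V" "v \<in> V" "u \<noteq> v" "N \<subseteq> V - {u, v}" "card N \<le> 2 * s"
        "\<not> isolating Ss u v N"
        by (auto simp: universal_family_def)
      then have "finite N" using V finite_subset by blast
      then obtain ys where ys: "set ys = N" "distinct ys" using finite_distinct_list by blast
      then have len: "length ys = card N" using distinct_card by force
      \<comment> \<open>Padding with \<open>u\<close> is harmless because \<open>?B\<close> removes
        \<open>u\<close> and \<open>v\<close> again.\<close>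
      define xs where "xs = ys @ replicate (2 * s - card N) u"
      have "xs \<in> ?lists" using uvN ys len by (auto simp: xs_def)
      moreover have "set xs - {u, v} = N" using uvN ys by (auto simp: xs_def)
      ultimately have "(u, v, xs) \<in> ?I" "Ss \<in> ?B (u, v, xs)" using uvN by auto
      then show "Ss \<in> (\<Union>i\<in>?I. ?B i)" by blast
    qed
  qed
  also have "\<dots> < 1"
  proof (cases "V = {}")
    case False
    have "card ?I = card V ^ (2 * s + 2)"
      using V by (simp add: card_cartesian_product card_lists_length_eq power_add power2_eq_square)
    also have "real (card V ^ (2 * s + 2)) \<le> exp (real l) ^ (2 * s + 2)"
      unfolding of_nat_power l_def by (intro power_mono real_le_exp_log_size) auto
    also have "\<dots> = exp (real (2 * s + 2) * real l)" by (rule exp_of_nat_mult[symmetric])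
    also have "\<dots> < exp (8 * real s * real l)"
    proof -
      have "real (2 * s + 2) < 8 * real s" using s by linarith
      moreover have "0 < real l" by (simp add: l_def log_size_def)
      ultimately show ?thesis by simp
    qed
    finally show ?thesis by (simp add: exp_minus divide_simps)
  qed simp
  finally have "measure_pmf.prob M {Ss. \<not> universal_family V (2 * s) Ss} < 1" .
  then obtain Ss where "Ss \<in> set_pmf M" "universal_family V (2 * s) Ss"
    using measure_pmf.prob_eq_1[of "{Ss. \<not> universal_family V (2 * s) Ss}" M]
    by (auto simp: AE_measure_pmf_iff)
  then show ?thesis
    by (auto simp: M_def set_replicate_pmf t_def l_def)
qed

section \<open>Families, thresholds and query count of the deterministic algorithm\<close>

definition all_pairs :: "nat \<Rightarrow> nat set list" where
  "all_pairs n = map (\<lambda>(u, v). {u, v}) (List.product [0..<n] [0..<n])"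

lemma universal_family_all_pairs: "universal_family {..<n} t (all_pairs n)"
proof -
  have "{u, v} \<in> set (all_pairs n)" if "u < n" "v < n" for u v
    using that by (force simp: all_pairs_def)
  then show ?thesis
    unfolding universal_family_def isolating_def
    by (metis Diff_disjoint Int_commute disjoint_iff insert_iff lessThan_iff subsetD DiffD2)
qed

lemma exact_for_universal_family:
  assumes "simple_graph V E" "universal_family V t Ss" "W \<subseteq> V"
  shows "exact_for E Ss t W"
  unfolding exact_for_def
proof (intro ballI impI)
  fix u v assume u: "u \<in> true_low E t W" and v: "v \<in> W" "v \<noteq> u" "v \<notin> nbrs E W u"
  have "nbrs E W u \<subseteq> V - {u, v}"
    using self_notin_nbrs[OF assms(1), of u W] v(3) assms(3) nbrs_subset[of E W u] by auto
  moreover have "u \<in> V" "v \<in> V" "card (nbrs E W u) \<le> t"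
    using assms(3) u v by (auto simp: true_low_def)
  ultimately show "isolating Ss u v (nbrs E W u)"
    using assms(2) v(2) unfolding universal_family_def by metis
qed

text \<open>The length in \<open>universal_family_exists\<close> for \<open>s = 2 ^ i\<close>, as
  \<open>8 ^ i = s ^ 3\<close>.\<close>

definition det_size :: "nat \<Rightarrow> nat \<Rightarrow> nat" where
  "det_size n i = 128 * 8 ^ i * log_size n"

text \<open>Once the universal family is as expensive as querying all pairs, all pairs are queried; as
  then every vertex counts as low, the algorithm ends with this round.\<close>

definition det_family :: "nat \<Rightarrow> nat \<Rightarrow> nat set list" where
  "det_family n i = (if n\<^sup>2 \<le> det_size n i then all_pairs n
     else SOME Ss. length Ss = det_size n i \<and> universal_family {..<n} (2 * 2 ^ i) Ss)"

text \<open>When all pairs are queried every vertex shall count as low, hence \<open>n\<close>;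
  adding \<open>i\<close> provides \<open>i \<le> tau i\<close> for the fuel argument.\<close>

definition det_threshold :: "nat \<Rightarrow> nat \<Rightarrow> nat" where
  "det_threshold n i = (if n\<^sup>2 \<le> det_size n i then n + i else 2 * 2 ^ i)"

text \<open>Universal families never err, so a failed batch itself proves the guess too small and
  the certificate is constantly true. The potential starts at \<open>2 * n\<close>, one below the
  fuel.\<close>

definition det_alg :: det_algorithm where
  "det_alg n = peel (det_family n) (det_threshold n) (\<lambda>_ _ _. True) (2 * n + 1) 0 {..<n} {}"

lemma det_family_SOME:
  assumes "\<not> n\<^sup>2 \<le> det_size n i"
  shows "length (det_family n i) = det_size n i \<and> universal_family {..<n} (2 * 2 ^ i) (det_family n i)"
proof -
  have "((2::nat) ^ i) ^ 3 = 8 ^ i" by (simp add: power_mult[symmetric] mult.commute[of i] power_mult)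
  then have "\<exists>Ss :: nat set list. length Ss = det_size n i \<and> universal_family {..<n} (2 * 2 ^ i) Ss"
    using universal_family_exists[of "{..<n}" "2 ^ i"] by (simp add: det_size_def)
  from someI_ex[OF this] show ?thesis
    using assms by (simp add: det_family_def)
qed

lemma universal_det_family: "universal_family {..<n} (det_threshold n i) (det_family n i)"
  using det_family_SOME[of n i] universal_family_all_pairs[of n]
  by (cases "n\<^sup>2 \<le> det_size n i") (auto simp: det_threshold_def det_family_def)

lemma length_det_family:
  "length (det_family n i) \<le> n\<^sup>2" "length (det_family n i) \<le> det_size n i"
  using det_family_SOME[of n i]
  by (cases "n\<^sup>2 \<le> det_size n i"; simp add: det_family_def all_pairs_def power2_eq_square)+

lemma det_threshold_ge: "i \<le> det_threshold n i" "2 ^ i \<le> det_threshold n i \<or> n\<^sup>2 \<le> det_size n i"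
proof -
  have "i \<le> 2 * 2 ^ i" using less_exp[of i] by linarith
  then show "i \<le> det_threshold n i" by (simp add: det_threshold_def)
qed (simp add: det_threshold_def)

lemma det_alg_correct: "det_solves_GR det_alg"
  unfolding det_solves_GR_def
proof (intro allI conjI impI)
  fix n
  show "queries_within {..<n} (det_alg n)"
    unfolding det_alg_def by (rule queries_within_peel) simp
  fix E assume E: "simple_graph {..<n} E"
  show "output_on (det_alg n) E = E"
    unfolding det_alg_def
  proof (rule output_on_peel[where X = "{(i, W). W \<subseteq> {..<n}}"])
    show "{} = {e \<in> E. \<not> e \<subseteq> {..<n}}"
      using E by (auto elim: simple_graph_edgeE)
    show "exact_for E (det_family n i) (det_threshold n i) W" if "(i, W) \<in> {(i, W). W \<subseteq> {..<n}}" for i W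
      using that E universal_det_family by (intro exact_for_universal_family) auto
  qed (use E det_threshold_ge(1) in \<open>auto simp: ideal_step_def Let_def split: if_splits\<close>)
qed

text \<open>\<open>S\<close> is the total length of the families up to the first guess that cannot
  fail, bounded once through all pairs and once through the degeneracy; the factor
  \<open>ln (n / D)\<close> results from combining both.\<close>

lemma det_alg_queries_nat:
  assumes E: "simple_graph {..<n} E"
  defines "D \<equiv> max 1 (degeneracy {..<n} E)"
  obtains S where "num_queries_on (det_alg n) E \<le> (floorlog 2 n + 1) * S"
    "S \<le> 3 * n\<^sup>2" "S \<le> 131072 * log_size n * D ^ 3"
proof -
  let ?d = "degeneracy {..<n} E"
  \<comment> \<open>\<open>Q i\<close> rules out a failed batch at guess \<open>i\<close>: either
    the threshold exceeds four times the degeneracy or all pairs are queried.\<close>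
  define Q where "Q = (\<lambda>i::nat. 4 * ?d < 2 ^ i \<or> n\<^sup>2 \<le> det_size n i)"
  define M where "M = (LEAST i. Q i)"
  define S where "S = (\<Sum>j\<le>M. length (det_family n j))"
  have mono: "det_size n i \<le> det_size n j" if "i \<le> j" for i j
    using that by (simp add: det_size_def power_increasing)
  have "Q (4 * ?d)" by (simp add: Q_def less_exp)
  then have QM: "Q M" unfolding M_def by (rule LeastI)
  have Q_mono: "Q j" if "Q i" "i \<le> j" for i j
    using that mono[of i j] power_increasing[of i j "2::nat"] unfolding Q_def by linarith
  have inc: "i < M"
    if W: "W \<subseteq> {..<n}" "W \<noteq> {}"
      and few: "\<not> card W \<le> 2 * card (low_vertices (answers E (det_family n i) W) W (det_threshold n i))"
    for i W
  proof -
    let ?t = "det_threshold n i"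
    have fin: "finite W" using W finite_subset by blast
    have "exact_for E (det_family n i) ?t W"
      using E universal_det_family W(1) by (rule exact_for_universal_family)
    then have few': "\<not> card W \<le> 2 * card (true_low E ?t W)"
      using few exact_low_vertices[OF E _ fin] by simp
    have "?t < card W" using few_low_imp_less[OF E fin few'] .
    also have "\<dots> \<le> n" using card_mono[OF _ W(1)] by simp
    finally have nb: "\<not> n\<^sup>2 \<le> det_size n i" by (auto simp: det_threshold_def)
    have "?t \<le> 4 * ?d"
    proof (rule degeneracy_ge_of_many_high[OF _ E W])
      show "card W \<le> 2 * card (W - true_low E ?t W)"
        using many_high_of_few_low[OF fin few'] by simp
    qed (auto simp: true_low_def)
    then have "\<not> Q i" using det_threshold_ge(2)[of i n] nb by (simp add: Q_def)
    then show "i < M" using Q_mono[OF QM] by (meson leI)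
  qed
  have "num_queries_on (det_alg n) E \<le> (floorlog 2 (card {..<n}) + 1) * S"
    unfolding det_alg_def S_def by (rule num_queries_on_peel) (use inc in auto)
  then have 1: "num_queries_on (det_alg n) E \<le> (floorlog 2 n + 1) * S" by simp
  have sum_size: "(\<Sum>j\<le>m. det_size n j) \<le> 2 * det_size n m" for m
  proof -
    have "(\<Sum>j\<le>m. det_size n j) = 128 * log_size n * (\<Sum>j\<le>m. 8 ^ j)"
      unfolding sum_distrib_left by (simp add: det_size_def mult_ac)
    also have "\<dots> \<le> 128 * log_size n * (2 * 8 ^ m)"
      using sum_power_le[of 8 m] by (intro mult_left_mono) auto
    finally show ?thesis by (simp add: det_size_def mult_ac)
  qed
  have notQ: "\<not> Q (M - 1)" if "0 < M"
    using that not_less_Least[of "M - 1" Q] unfolding M_def by simp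
  have 2: "S \<le> 3 * n\<^sup>2"
  proof (cases M)
    case 0
    then have "S \<le> n\<^sup>2" unfolding S_def using length_det_family(1)[of n 0] by simp
    then show ?thesis by simp
  next
    case (Suc m)
    have "S = (\<Sum>j\<le>m. length (det_family n j)) + length (det_family n M)"
      unfolding S_def Suc by simp
    \<comment> \<open>Guess \<open>M\<close> is charged \<open>n ^ 2\<close>; the earlier ones sum
      to at most twice the size at \<open>m = M - 1\<close>, which is below \<open>n ^ 2\<close> by
      minimality of \<open>M\<close>.\<close>
    also have "\<dots> \<le> (\<Sum>j\<le>m. det_size n j) + n\<^sup>2"
      by (intro add_mono sum_mono length_det_family)
    also have "\<dots> \<le> 2 * det_size n m + n\<^sup>2" using sum_size[of m] by simp
    also have "\<dots> \<le> 3 * n\<^sup>2" using notQ Suc by (simp add: Q_def)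
    finally show ?thesis .
  qed
  have 3: "S \<le> 131072 * log_size n * D ^ 3"
  proof -
    \<comment> \<open>By minimality \<open>2 ^ (M - 1) \<le> 4 * D\<close> unless
      \<open>M = 0\<close>; cubing gives \<open>512 = 8 * 4 ^ 3\<close>.\<close>
    have "8 ^ M \<le> 512 * D ^ 3"
    proof (cases M)
      case (Suc m)
      have "?d \<le> D" by (simp add: D_def)
      moreover have "2 ^ m \<le> 4 * ?d" using notQ Suc by (simp add: Q_def)
      ultimately have "2 ^ m \<le> 4 * D" by linarith
      then have "((2::nat) ^ m) ^ 3 \<le> (4 * D) ^ 3" by (rule power_mono) simp
      moreover have "((2::nat) ^ m) ^ 3 = 8 ^ m" by (simp add: power_mult[symmetric] mult.commute[of m] power_mult)
      ultimately show ?thesis using Suc by (simp add: power_mult_distrib)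
    next
      case 0
      have "1 \<le> D ^ 3" by (simp add: D_def)
      then show ?thesis using 0 by simp
    qed
    have "S \<le> (\<Sum>j\<le>M. det_size n j)"
      unfolding S_def by (intro sum_mono length_det_family)
    also have "\<dots> \<le> 256 * log_size n * 8 ^ M" using sum_size[of M] by (simp add: det_size_def mult_ac)
    also have "\<dots> \<le> 256 * log_size n * (512 * D ^ 3)"
      using \<open>8 ^ M \<le> 512 * D ^ 3\<close> by (rule mult_left_mono) simp
    finally show ?thesis by (simp add: mult_ac)
  qed
  show ?thesis using that 1 2 3 .
qed

text \<open>If \<open>D ^ 3 \<le> n ^ 2\<close>, then \<open>ln n \<le> 3 * ln (n / D)\<close> and
  the cubic bound serves. Otherwise \<open>n ^ 2\<close> itself is at most
  \<open>8 * D ^ 3 * ln (n / D)\<close>.\<close>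

lemma min_le_cube_mult_ln:
  fixes n D S :: real
  assumes "1 \<le> D" "D \<le> n - 1" "2 \<le> n" "S \<le> 3 * n\<^sup>2" "S \<le> c * D ^ 3 * ln n" "8 \<le> c"
  shows "S \<le> 3 * c * D ^ 3 * ln (n / D)"
proof (cases "D ^ 3 \<le> n\<^sup>2")
  case True
  then have "ln (D ^ 3) \<le> ln (n\<^sup>2)" using assms by simp
  then have "3 * ln D \<le> 2 * ln n" using assms by (simp add: ln_realpow)
  then have "ln n \<le> 3 * ln (n / D)" using assms by (simp add: ln_div)
  then have "c * D ^ 3 * ln n \<le> c * D ^ 3 * (3 * ln (n / D))"
    using assms by (intro mult_left_mono) auto
  then show ?thesis using assms(5) by simp
next
  case False
  have ln: "1 - D / n \<le> ln (n / D)"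
    using ln_le_minus_one[of "D / n"] assms by (simp add: ln_div)
  \<comment> \<open>For \<open>D\<close> above \<open>n / 2\<close> the cube is at least
    \<open>n ^ 3 / 8\<close>, which makes up for the weak bound \<open>1 - D / n \<ge> 1 / n\<close>
    coming from \<open>D \<le> n - 1\<close>.\<close>
  have "n\<^sup>2 / 8 \<le> D ^ 3 * (1 - D / n)"
  proof (cases "D \<le> n / 2")
    case True
    then have "1 / 2 \<le> 1 - D / n" using assms by (simp add: field_simps)
    then have "n\<^sup>2 * (1 / 2) \<le> D ^ 3 * (1 - D / n)"
      using False assms by (intro mult_mono) auto
    then show ?thesis using zero_le_power2[of n] by linarith
  next
    case False
    then have "(n / 2) ^ 3 \<le> D ^ 3" using assms by (intro power_mono) auto
    moreover have "1 / n \<le> 1 - D / n" using assms by (simp add: field_simps)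
    ultimately have "(n / 2) ^ 3 * (1 / n) \<le> D ^ 3 * (1 - D / n)"
      using assms by (intro mult_mono) auto
    moreover have "(n / 2) ^ 3 * (1 / n) = n\<^sup>2 / 8"
      using assms by (simp add: power3_eq_cube power2_eq_square)
    ultimately show ?thesis by linarith
  qed
  also have "\<dots> \<le> D ^ 3 * ln (n / D)" using ln assms by (intro mult_left_mono) auto
  finally have "n\<^sup>2 \<le> 8 * (D ^ 3 * ln (n / D))" by simp
  moreover have "8 * (D ^ 3 * ln (n / D)) \<le> c * (D ^ 3 * ln (n / D))"
    using assms by (intro mult_right_mono) auto
  ultimately show ?thesis using assms(4) by (simp add: mult.assoc)
qed

lemma det_alg_queries:
  assumes n: "2 \<le> n" and E: "simple_graph {..<n} E"
  shows "real (num_queries_on (det_alg n) E)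
    \<le> 7864320 * (degeneracy1 n E) ^ 3 * ln (real n) * ln (real n / degeneracy1 n E)"
proof -
  define D where "D = max 1 (degeneracy {..<n} E)"
  obtain S where S: "num_queries_on (det_alg n) E \<le> (floorlog 2 n + 1) * S"
    "S \<le> 3 * n\<^sup>2" "S \<le> 131072 * log_size n * D ^ 3"
    using det_alg_queries_nat[OF E] unfolding D_def by metis
  have D: "1 \<le> D" "D \<le> n - 1"
    using degeneracy_le_card[OF _ E] n by (auto simp: D_def)
  have "real S \<le> 131072 * real (log_size n) * real D ^ 3"
    using of_nat_mono[OF S(3), where ?'a = real] by simp
  also have "\<dots> \<le> 131072 * (4 * ln (real n)) * real D ^ 3"
    using log_size_le[OF n] by (intro mult_right_mono mult_left_mono) auto
  finally have S3: "real S \<le> 524288 * real D ^ 3 * ln (real n)" by (simp add: mult_ac)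
  have S2: "real S \<le> 3 * (real n)\<^sup>2"
    using of_nat_mono[OF S(2), where ?'a = real] by simp
  have "real S \<le> 3 * 524288 * real D ^ 3 * ln (real n / real D)"
    using D n S2 S3 by (intro min_le_cube_mult_ln) auto
  then have "real (floorlog 2 n + 1) * real S
      \<le> (5 * ln (real n)) * (3 * 524288 * real D ^ 3 * ln (real n / real D))"
    using floorlog_le_ln[OF n] n by (intro mult_mono) auto
  moreover have "real (num_queries_on (det_alg n) E) \<le> real (floorlog 2 n + 1) * real S"
    using of_nat_mono[OF S(1), where ?'a = real] by (simp only: of_nat_mult)
  ultimately show ?thesis
    unfolding degeneracy1_def D_def[symmetric] by (simp add: mult_ac)
qed

section \<open>The randomized algorithm\<close>

text \<open>The factor 16 lets hits beat the certificate's demand: above the threshold,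
  \<open>prob_few_hits_le\<close> has the exponent \<open>- 256 * 2 ^ i * log_size n\<close> against
  \<open>2 ^ k\<close> with \<open>k = 128 * 2 ^ i * log_size n\<close>.\<close>

definition rand_scale :: "nat \<Rightarrow> nat" where
  "rand_scale i = 16 * 2 ^ i"

definition rand_size :: "nat \<Rightarrow> nat \<Rightarrow> nat" where
  "rand_size n i = 128 * (rand_scale i)\<^sup>2 * log_size n"

text \<open>Four times the expected number of sets in one family that contain a given pair.\<close>

definition pair_bound :: "nat \<Rightarrow> nat" where
  "pair_bound n = 128 * log_size n"

definition rand_threshold :: "nat \<Rightarrow> nat" where
  "rand_threshold i = 2 * rand_scale i"

text \<open>The first conjunct inspects the drawn family itself; it makes the certificate sound with
  certainty rather than with high probability.\<close>

definition high_degree_cert :: "nat \<Rightarrow> (nat \<Rightarrow> nat set list) \<Rightarrow> nat \<Rightarrow> nat set \<Rightarrow> nat set set list \<Rightarrow> bool" where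
  "high_degree_cert n fam i W Ps \<longleftrightarrow>
    (\<forall>u<n. \<forall>v<n. v \<noteq> u \<longrightarrow> pair_count (fam i) u v \<le> pair_bound n) \<and>
    card W \<le> 2 * card {u \<in> W. 2 ^ i * pair_bound n < nonisolated_count Ps u}"

definition rand_tree :: "nat \<Rightarrow> (nat \<Rightarrow> nat set list) \<Rightarrow> nat cc_algorithm" where
  "rand_tree n fam = peel fam rand_threshold (high_degree_cert n fam) (2 * n + 1) 0 {..<n} {}"

definition sets_pmf :: "nat \<Rightarrow> nat \<Rightarrow> nat set list pmf" where
  "sets_pmf n i = replicate_pmf (rand_size n i) (random_set {..<n} (1 / real (2 * rand_scale i)))"

text \<open>Index \<open>n\<close> is never exceeded by the guesses that occur in a successful run.\<close>

definition family_pmf :: "nat \<Rightarrow> (nat \<Rightarrow> nat set list) pmf" where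
  "family_pmf n = Pi_pmf {..n} [] (sets_pmf n)"

definition rand_alg :: rand_algorithm where
  "rand_alg n = map_pmf (rand_tree n) (family_pmf n)"

lemma le_rand_threshold: "i \<le> rand_threshold i"
  using less_exp[of i] unfolding rand_threshold_def rand_scale_def by linarith

section \<open>Query bound for every outcome of the coins\<close>

lemma length_family:
  assumes "fam \<in> set_pmf (family_pmf n)"
  shows "length (fam i) \<le> rand_size n i"
proof (cases "i \<le> n")
  case True
  then have "fam i \<in> set_pmf (sets_pmf n i)"
    using assms by (auto simp: family_pmf_def set_Pi_pmf PiE_dflt_def)
  then show ?thesis by (simp add: sets_pmf_def set_replicate_pmf)
next
  case False
  then have "fam i = []"
    using assms by (auto simp: family_pmf_def set_Pi_pmf PiE_dflt_def)
  then show ?thesis by simp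
qed

text \<open>Each neighbour accounts for at most \<open>pair_bound n\<close> non-isolated queries, so
  a certified vertex has more than \<open>2 ^ i\<close> neighbours, and half of \<open>W\<close> is
  certified. This holds for every family.\<close>

lemma high_degree_cert_sound:
  assumes E: "simple_graph {..<n} E" and W: "W \<subseteq> {..<n}" "W \<noteq> {}"
    and cert: "high_degree_cert n fam i W (answers E (fam i) W)"
  shows "2 ^ i \<le> 4 * degeneracy {..<n} E"
proof (rule degeneracy_ge_of_many_high[OF _ E W])
  let ?A = "{u \<in> W. 2 ^ i * pair_bound n < nonisolated_count (answers E (fam i) W) u}"
  show "card W \<le> 2 * card ?A" using cert by (simp add: high_degree_cert_def)
  fix u assume u: "u \<in> ?A"
  have "nonisolated_count (answers E (fam i) W) u \<le> pair_bound n * card (nbrs E W u)"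
  proof (rule nonisolated_count_le[OF _ _ E])
    show "finite W" using W finite_subset by blast
    show "pair_count (fam i) u v \<le> pair_bound n" if "v \<in> W" "v \<noteq> u" for v
      using that u W(1) cert unfolding high_degree_cert_def by blast
  qed
  moreover have "2 ^ i * pair_bound n < nonisolated_count (answers E (fam i) W) u"
    using u by simp
  ultimately have "2 ^ i * pair_bound n < card (nbrs E W u) * pair_bound n"
    by (simp only: mult.commute[of "pair_bound n"])
  then show "2 ^ i \<le> card (nbrs E W u)" by simp
qed auto

lemma rand_tree_queries:
  assumes n: "2 \<le> n" and E: "simple_graph {..<n} E" and fam: "fam \<in> set_pmf (family_pmf n)"
  shows "real (num_queries_on (rand_tree n fam) E)
    \<le> 83886080 * (degeneracy1 n E)\<^sup>2 * (ln (real n))\<^sup>2"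
proof -
  let ?d = "degeneracy {..<n} E"
  define D where "D = max 1 ?d"
  \<comment> \<open>By soundness of the certificates no guess from \<open>M\<close> on is ever
    raised.\<close>
  define M where "M = (LEAST i::nat. 4 * ?d < 2 ^ i)"
  define S where "S = (\<Sum>j\<le>M. length (fam j))"
  have M: "4 * ?d < 2 ^ M"
    unfolding M_def using less_exp by (rule LeastI)
  have inc: "i < M" if "2 ^ i \<le> 4 * ?d" for i
  proof -
    have "(2::nat) ^ i < 2 ^ M" using that M by linarith
    then show ?thesis by simp
  qed
  have "num_queries_on (rand_tree n fam) E \<le> (floorlog 2 (card {..<n}) + 1) * S"
    unfolding rand_tree_def S_def
    by (rule num_queries_on_peel) (auto intro: inc high_degree_cert_sound[OF E])
  then have Q: "num_queries_on (rand_tree n fam) E \<le> (floorlog 2 n + 1) * S" by simp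
  have size: "rand_size n j = 32768 * log_size n * 4 ^ j" for j
  proof -
    have "((2::nat) ^ j)\<^sup>2 = 4 ^ j" by (simp add: power_mult[symmetric] mult.commute[of j] power_mult)
    then show ?thesis by (simp add: rand_size_def rand_scale_def power_mult_distrib)
  qed
  have "4 ^ M \<le> 64 * D\<^sup>2"
  proof (cases M)
    case (Suc m)
    have "?d \<le> D" by (simp add: D_def)
    moreover have "2 ^ m \<le> 4 * ?d"
      using not_less_Least[of m "\<lambda>i. 4 * ?d < 2 ^ i"] Suc unfolding M_def by simp
    ultimately have "2 ^ m \<le> 4 * D" by linarith
    then have "((2::nat) ^ m)\<^sup>2 \<le> (4 * D)\<^sup>2" by (rule power_mono) simp
    moreover have "((2::nat) ^ m)\<^sup>2 = 4 ^ m" by (simp add: power_mult[symmetric] mult.commute[of m] power_mult)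
    ultimately show ?thesis using Suc by (simp add: power_mult_distrib)
  next
    case 0
    have "1 \<le> D\<^sup>2" by (simp add: D_def)
    then show ?thesis using 0 by simp
  qed
  have "S \<le> (\<Sum>j\<le>M. rand_size n j)"
    unfolding S_def by (intro sum_mono length_family[OF fam])
  also have "\<dots> = 32768 * log_size n * (\<Sum>j\<le>M. 4 ^ j)"
    unfolding sum_distrib_left by (simp add: size)
  also have "\<dots> \<le> 32768 * log_size n * (2 * (64 * D\<^sup>2))"
    using sum_power_le[of 4 M] \<open>4 ^ M \<le> 64 * D\<^sup>2\<close> by (intro mult_left_mono) auto
  finally have "S \<le> 4194304 * log_size n * D\<^sup>2" by simp
  from of_nat_mono[OF this, where ?'a = real]
  have "real S \<le> 4194304 * real (log_size n) * (real D)\<^sup>2" by simp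
  also have "\<dots> \<le> 4194304 * (4 * ln (real n)) * (real D)\<^sup>2"
    using log_size_le[OF n] by (intro mult_right_mono mult_left_mono) auto
  finally have "real (floorlog 2 n + 1) * real S
      \<le> (5 * ln (real n)) * (4194304 * (4 * ln (real n)) * (real D)\<^sup>2)"
    using floorlog_le_ln[OF n] n by (intro mult_mono) auto
  moreover have "real (num_queries_on (rand_tree n fam) E) \<le> real (floorlog 2 n + 1) * real S"
    using of_nat_mono[OF Q, where ?'a = real] by (simp only: of_nat_mult)
  ultimately show ?thesis
    unfolding degeneracy1_def D_def[symmetric] by (simp add: power2_eq_square mult_ac)
qed

section \<open>Failure of a random family at a fixed state\<close>

definition bad_sets :: "nat \<Rightarrow> nat edges \<Rightarrow> nat \<times> nat set \<Rightarrow> nat set list set" where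
  "bad_sets n E = (\<lambda>(i, W). {Ss. \<not> exact_for E Ss (rand_threshold i) W
     \<or> (\<exists>u\<in>W. rand_threshold i < card (nbrs E W u) \<and>
          length (filter (\<lambda>S. u \<in> S \<and> nbrs E W u \<inter> S \<noteq> {}) Ss) \<le> 2 ^ i * pair_bound n)
     \<or> (\<exists>u<n. \<exists>v<n. u \<noteq> v \<and> pair_bound n \<le> pair_count Ss u v)})"

lemma two_power_le_exp: "(2::real) ^ k \<le> exp (real k)"
proof -
  have "(2::real) ^ k \<le> exp 1 ^ k"
    using exp_ge_add_one_self[of 1] by (intro power_mono) auto
  then show ?thesis by (simp add: exp_of_nat_mult[symmetric])
qed

text \<open>Union bound over \<open>2 * n ^ 2 + n\<close> events, each of probability at most
  \<open>exp (- 8 * log_size n)\<close>: a missing isolating set, a high vertex hit too rarely, an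
  overloaded pair.\<close>

lemma prob_bad_sets:
  assumes E: "simple_graph {..<n} E" and W: "W \<subseteq> {..<n}"
  shows "measure_pmf.prob (sets_pmf n i) (bad_sets n E (i, W)) \<le> 3 * real n ^ 2 * exp (- 8 * real (log_size n))"
proof -
  let ?V = "{..<n}" and ?L = "log_size n" and ?s = "rand_scale i" and ?t = "rand_threshold i"
  let ?e = "exp (- 8 * real ?L)"
  let ?N = "nbrs E W"
  \<comment> \<open>The events are empty where their side conditions fail, so that all pairs and all
    vertices can serve as indices.\<close>
  define Biso where "Biso = (\<lambda>(u, v). if u \<in> true_low E ?t W \<and> v \<in> W \<and> v \<noteq> u \<and> v \<notin> ?N u
    then {Ss. \<not> isolating Ss u v (?N u)} else {})"
  define Bfew where "Bfew = (\<lambda>u. if u \<in> W \<and> ?t < card (?N u)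
    then {Ss. length (filter (\<lambda>S. u \<in> S \<and> ?N u \<inter> S \<noteq> {}) Ss) \<le> 2 ^ i * pair_bound n} else {})"
  define Bpair where "Bpair = (\<lambda>(u :: nat, v). if u \<noteq> v then {Ss. pair_bound n \<le> pair_count Ss u v} else {})"
  have s: "0 < ?s" by (simp add: rand_scale_def)
  have L: "0 < real ?L" by (simp add: log_size_def)
  have size: "real (rand_size n i) = 128 * (real ?s)\<^sup>2 * real ?L" by (simp add: rand_size_def)
  have N: "?N u \<subseteq> ?V - {u}" for u
    using self_notin_nbrs[OF E, of u W] nbrs_subset[of E W u] W by auto
  have iso: "measure_pmf.prob (sets_pmf n i) (Biso uv) \<le> ?e" if uvV: "uv \<in> ?V \<times> ?V" for uv
  proof -
    obtain u v where uv: "uv = (u, v)" "u < n" "v < n" using uvV by auto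
    show ?thesis
    proof (cases "u \<in> true_low E ?t W \<and> v \<in> W \<and> v \<noteq> u \<and> v \<notin> ?N u")
      case True
      have "measure_pmf.prob (sets_pmf n i) {Ss. \<not> isolating Ss u v (?N u)}
          \<le> exp (- ((1 / (16 * real ?s ^ 2)) * real (rand_size n i)))"
        unfolding sets_pmf_def
        using True N[of u] uv s
        by (intro prob_not_isolating_le) (auto simp: true_low_def rand_threshold_def)
      also have "(1 / (16 * real ?s ^ 2)) * real (rand_size n i) = 8 * real ?L"
        using s by (simp add: size)
      finally show ?thesis using True by (simp add: Biso_def uv)
    qed (auto simp: Biso_def uv)
  qed
  have few: "measure_pmf.prob (sets_pmf n i) (Bfew u) \<le> ?e" if "u \<in> ?V" for u
  proof (cases "u \<in> W \<and> ?t < card (?N u)")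
    case True
    let ?k = "2 ^ i * pair_bound n"
    have "measure_pmf.prob (sets_pmf n i) {Ss. length (filter (\<lambda>S. u \<in> S \<and> ?N u \<inter> S \<noteq> {}) Ss) \<le> ?k}
        \<le> 2 ^ ?k * exp (- ((1 / (4 * real ?s)) * real (rand_size n i) / 2))"
      unfolding sets_pmf_def
      using that True N[of u] s by (intro prob_few_hits_le) (auto simp: rand_threshold_def)
    also have "\<dots> \<le> exp (real ?k) * exp (- ((1 / (4 * real ?s)) * real (rand_size n i) / 2))"
      by (intro mult_right_mono two_power_le_exp) simp
    also have "\<dots> = exp (real ?k - (1 / (4 * real ?s)) * real (rand_size n i) / 2)"
      by (simp only: exp_add[symmetric] diff_conv_add_uminus)
    also have "real ?k = 128 * (2 ^ i * real ?L)" by (simp add: pair_bound_def)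
    also have "(1 / (4 * real ?s)) * real (rand_size n i) / 2 = 16 * real ?s * real ?L"
      using s by (simp add: size power2_eq_square)
    also have "16 * real ?s * real ?L = 256 * (2 ^ i * real ?L)" by (simp add: rand_scale_def)
    also have "exp (128 * (2 ^ i * real ?L) - 256 * (2 ^ i * real ?L)) \<le> ?e"
    proof -
      have "1 * real ?L \<le> 2 ^ i * real ?L" by (intro mult_right_mono) auto
      then show ?thesis using L unfolding exp_le_cancel_iff by linarith
    qed
    finally show ?thesis using True by (simp add: Bfew_def)
  qed (auto simp: Bfew_def)
  have pair: "measure_pmf.prob (sets_pmf n i) (Bpair uv) \<le> ?e" if uvV: "uv \<in> ?V \<times> ?V" for uv
  proof -
    obtain u v where uv: "uv = (u, v)" "u < n" "v < n" using uvV by auto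
    show ?thesis
    proof (cases "u = v")
      case False
      have "measure_pmf.prob (sets_pmf n i) {Ss. pair_bound n \<le> pair_count Ss u v}
          \<le> exp ((1 / (4 * real ?s ^ 2)) * real (rand_size n i)) / 2 ^ pair_bound n"
        unfolding sets_pmf_def using uv False s by (intro prob_pair_count_ge_le) auto
      also have "(1 / (4 * real ?s ^ 2)) * real (rand_size n i) = 32 * real ?L"
        using s by (simp add: size)
      \<comment> \<open>As \<open>e \<le> 4\<close>, the denominator
        \<open>4 ^ (64 * log_size n)\<close> leaves ample room for the 40, chosen because
        \<open>32 - 40 = - 8\<close>.\<close>
      also have "exp (32 * real ?L) / 2 ^ pair_bound n \<le> exp (32 * real ?L) / exp (40 * real ?L)"
      proof (intro divide_left_mono)
        have "exp 1 \<le> (4::real)" using exp_le by linarith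
        then have "exp 1 ^ (64 * ?L) \<le> (4::real) ^ (64 * ?L)" by (intro power_mono) auto
        also have "\<dots> = (2\<^sup>2) ^ (64 * ?L)" by simp
        also have "\<dots> = 2 ^ pair_bound n" unfolding pair_bound_def power_mult[symmetric] by simp
        finally have "exp (64 * real ?L) \<le> 2 ^ pair_bound n" by (simp add: exp_of_nat_mult[symmetric])
        moreover have "exp (40 * real ?L) \<le> exp (64 * real ?L)" using L by simp
        ultimately show "exp (40 * real ?L) \<le> 2 ^ pair_bound n" by linarith
      qed auto
      also have "\<dots> = ?e" by (simp flip: exp_diff)
      finally show ?thesis using False by (simp add: Bpair_def uv)
    qed (auto simp: Bpair_def uv)
  qed
  let ?I = "(?V \<times> ?V) <+> (?V <+> (?V \<times> ?V))"
  have "measure_pmf.prob (sets_pmf n i) (bad_sets n E (i, W))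
      \<le> real (card ?I) * ?e"
  proof (rule prob_UN_le)
    show "measure_pmf.prob (sets_pmf n i) (case_sum Biso (case_sum Bfew Bpair) x) \<le> ?e"
      if "x \<in> ?I" for x
      using that iso few pair by auto
    show "bad_sets n E (i, W) \<subseteq> (\<Union>x\<in>?I. case_sum Biso (case_sum Bfew Bpair) x)"
    proof
      fix Ss assume "Ss \<in> bad_sets n E (i, W)"
      then consider
          (1) u v where "u \<in> true_low E ?t W" "v \<in> W" "v \<noteq> u" "v \<notin> ?N u" "\<not> isolating Ss u v (?N u)"
        | (2) u where "u \<in> W" "?t < card (?N u)"
            "length (filter (\<lambda>S. u \<in> S \<and> ?N u \<inter> S \<noteq> {}) Ss) \<le> 2 ^ i * pair_bound n"
        | (3) u v where "u < n" "v < n" "u \<noteq> v" "pair_bound n \<le> pair_count Ss u v"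
        unfolding bad_sets_def exact_for_def by auto
      then show "Ss \<in> (\<Union>x\<in>?I. case_sum Biso (case_sum Bfew Bpair) x)"
      proof cases
        case 1
        then have "Inl (u, v) \<in> ?I" "Ss \<in> Biso (u, v)" using W by (auto simp: Biso_def true_low_def)
        then show ?thesis by (intro UN_I[of "Inl (u, v)"]) auto
      next
        case 2
        then have "Inr (Inl u) \<in> ?I" "Ss \<in> Bfew u" using W by (auto simp: Bfew_def)
        then show ?thesis by (intro UN_I[of "Inr (Inl u)"]) auto
      next
        case 3
        then have "Inr (Inr (u, v)) \<in> ?I" "Ss \<in> Bpair (u, v)" by (auto simp: Bpair_def)
        then show ?thesis by (intro UN_I[of "Inr (Inr (u, v))"]) auto
      qed
    qed
  qed auto
  also have "real (card ?I) \<le> 3 * real n ^ 2"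
  proof -
    have "card ?I = 2 * n ^ 2 + n"
      by (simp add: card_Plus card_cartesian_product power2_eq_square)
    moreover have "n \<le> n ^ 2" by (simp add: power2_eq_square)
    ultimately have "card ?I \<le> 3 * n ^ 2" by linarith
    from of_nat_mono[OF this, where ?'a = real] show ?thesis by simp
  qed
  finally show ?thesis by (simp add: mult_right_mono)
qed

text \<open>Fixed before any coin is tossed. The actual run is adaptive and uses one family for
  several \<open>W\<close>, but it follows this trajectory unless a family is bad at one of its
  states; so a union bound over the trajectory suffices.\<close>

definition ideal_run :: "nat \<Rightarrow> nat edges \<Rightarrow> nat \<Rightarrow> nat \<times> nat set" where
  "ideal_run n E r = (ideal_step E rand_threshold ^^ r) (0, {..<n})"

text \<open>The potential of \<open>output_on_peel\<close> falls in every step until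
  \<open>W\<close> is empty, which is a fixed point. The guess stays in \<open>{..n}\<close> since
  it is raised only while its threshold is below \<open>n\<close>.\<close>

lemma ideal_run_inv:
  assumes E: "simple_graph {..<n} E" and "ideal_run n E r = (i, W)"
  shows "W \<subseteq> {..<n} \<and> i \<le> n \<and> (W = {} \<or> card W + (n - i) + r \<le> 2 * n)"
  using assms(2)
proof (induction r arbitrary: i W)
  case 0
  then show ?case by (auto simp: ideal_run_def)
next
  case (Suc r)
  obtain j U where jU: "ideal_run n E r = (j, U)" by fastforce
  note IH = Suc.IH[OF jU]
  have step: "ideal_step E rand_threshold (j, U) = (i, W)"
    using Suc.prems jU by (simp add: ideal_run_def)
  define L where "L = true_low E (rand_threshold j) U"
  have L: "L \<subseteq> U" by (auto simp: L_def true_low_def)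
  have fin: "finite U" using IH finite_subset by blast
  show ?case
  proof (cases "card U \<le> 2 * card L")
    case True
    then have iW: "i = j" "W = U - L" using step by (auto simp: ideal_step_def L_def)
    show ?thesis
    proof (cases "U = {}")
      case False
      then have "0 < card U" using fin by (simp add: card_gt_0_iff)
      then have "card W < card U"
        unfolding iW using True L fin by (simp add: card_Diff_subset finite_subset)
      then show ?thesis using IH iW False by auto
    qed (use IH iW in auto)
  next
    case False
    then have iW: "i = Suc j" "W = U" using step by (simp_all add: ideal_step_def L_def)
    have "rand_threshold j < card U"
      using few_low_imp_less[OF E fin] False by (simp add: L_def)
    moreover have "card U \<le> n" using IH card_mono[of "{..<n}" U] by simp
    ultimately have "j < n" using le_rand_threshold[of j] by linarith
    then show ?thesis using IH iW by auto
  qed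
qed

lemma rand_tree_correct:
  assumes E: "simple_graph {..<n} E"
    and good: "\<And>r. r \<le> 2 * n \<Longrightarrow> fam (fst (ideal_run n E r)) \<notin> bad_sets n E (ideal_run n E r)"
  shows "output_on (rand_tree n fam) E = E"
  unfolding rand_tree_def
proof (rule output_on_peel[where X = "ideal_run n E ` {..2 * n}"])
  show "(0, {..<n}) \<in> ideal_run n E ` {..2 * n}"
    by (rule image_eqI[of _ _ 0]) (auto simp: ideal_run_def)
  show "{} = {e \<in> E. \<not> e \<subseteq> {..<n}}"
    using E by (auto elim: simple_graph_edgeE)
  fix i W assume iW: "(i, W) \<in> ideal_run n E ` {..2 * n}"
  then obtain r where r: "r \<le> 2 * n" "ideal_run n E r = (i, W)" by auto
  note inv = ideal_run_inv[OF E r(2)]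
  have fin: "finite W" using inv finite_subset by blast
  have g: "fam i \<notin> bad_sets n E (i, W)" using good[OF r(1)] r(2) by simp
  show "W \<subseteq> {..<n}" using inv by simp
  show "exact_for E (fam i) (rand_threshold i) W" using g by (simp add: bad_sets_def)
  show "ideal_step E rand_threshold (i, W) \<in> ideal_run n E ` {..2 * n}" if "W \<noteq> {}"
  proof (rule image_eqI)
    show "ideal_step E rand_threshold (i, W) = ideal_run n E (Suc r)"
      using r(2) by (simp add: ideal_run_def)
    \<comment> \<open>A nonempty \<open>W\<close> has positive potential, so
      \<open>r < 2 * n\<close> and one more step remains on the trajectory.\<close>
    have "0 < card W" using that fin by (simp add: card_gt_0_iff)
    then show "Suc r \<in> {..2 * n}" using inv that by auto
  qed
  show "high_degree_cert n fam i W (answers E (fam i) W)"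
    if few: "\<not> card W \<le> 2 * card (true_low E (rand_threshold i) W)"
    unfolding high_degree_cert_def
  proof (intro conjI allI impI)
    show "pair_count (fam i) u v \<le> pair_bound n" if "u < n" "v < n" "v \<noteq> u" for u v
      using g that by (force simp: bad_sets_def)
    have "2 ^ i * pair_bound n < nonisolated_count (answers E (fam i) W) u"
      if "u \<in> W - true_low E (rand_threshold i) W" for u
    proof -
      have "2 ^ i * pair_bound n < length (filter (\<lambda>S. u \<in> S \<and> nbrs E W u \<inter> S \<noteq> {}) (fam i))"
        using g that by (force simp: bad_sets_def true_low_def)
      also have "\<dots> \<le> nonisolated_count (answers E (fam i) W) u"
        using nonisolated_count_ge[OF E] that by auto
      finally show ?thesis .
    qed
    then have "card (W - true_low E (rand_threshold i) W)
        \<le> card {u \<in> W. 2 ^ i * pair_bound n < nonisolated_count (answers E (fam i) W) u}"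
      using fin by (intro card_mono) auto
    then show "card W \<le> 2 * card {u \<in> W. 2 ^ i * pair_bound n < nonisolated_count (answers E (fam i) W) u}"
      using many_high_of_few_low(2)[OF fin few] by linarith
  qed
qed (use E le_rand_threshold in auto)

lemma rand_alg_success:
  assumes E: "simple_graph {..<n} E" and n: "1 \<le> n"
  shows "1 - 9 / real n \<le> measure_pmf.prob (rand_alg n) {T. output_on T E = E}"
proof -
  let ?e = "exp (- 8 * real (log_size n))"
  let ?run = "ideal_run n E"
  have "measure_pmf.prob (rand_alg n) {T. \<not> output_on T E = E}
      = measure_pmf.prob (family_pmf n) {fam. output_on (rand_tree n fam) E \<noteq> E}"
    by (simp add: rand_alg_def measure_map_pmf vimage_def)
  also have "\<dots> \<le> real (card {..2 * n}) * (3 * real n ^ 2 * ?e)"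
  proof (rule prob_UN_le)
    show "{fam. output_on (rand_tree n fam) E \<noteq> E}
        \<subseteq> (\<Union>r\<in>{..2 * n}. {fam. fam (fst (?run r)) \<in> bad_sets n E (?run r)})"
      using rand_tree_correct[OF E] by blast
    fix r assume "r \<in> {..2 * n}"
    obtain i W where iW: "?run r = (i, W)" by fastforce
    note inv = ideal_run_inv[OF E iW]
    \<comment> \<open>The invariant gives \<open>i \<le> n\<close>, so this component is a random
      family and not the default \<open>[]\<close>.\<close>
    have "map_pmf (\<lambda>fam. fam i) (family_pmf n) = sets_pmf n i"
      unfolding family_pmf_def using inv by (subst Pi_pmf_component) auto
    moreover have "measure_pmf.prob (map_pmf (\<lambda>fam. fam i) (family_pmf n)) (bad_sets n E (i, W))
        = measure_pmf.prob (family_pmf n) {fam. fam i \<in> bad_sets n E (i, W)}"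
      by (simp add: measure_map_pmf vimage_def)
    ultimately show "measure_pmf.prob (family_pmf n) {fam. fam (fst (?run r)) \<in> bad_sets n E (?run r)}
        \<le> 3 * real n ^ 2 * ?e"
      using prob_bad_sets[OF E, of W i] inv by (simp add: iW)
  qed simp
  also have "\<dots> \<le> (3 * real n) * (3 * real n ^ 2 * ?e)"
    using n by (intro mult_right_mono) auto
  also have "\<dots> \<le> (3 * real n) * (3 * real n ^ 2 * (1 / real n ^ 4))"
  proof (intro mult_left_mono)
    \<comment> \<open>The bound \<open>1 / n ^ 4\<close> is enough: at most \<open>3 * n\<close>
      states with \<open>3 * n ^ 2\<close> each leave \<open>9 / n\<close>.\<close>
    have "?e \<le> exp (- (4 * real (log_size n)))" by simp
    also have "\<dots> = 1 / exp (real (log_size n)) ^ 4"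
      by (simp add: exp_minus inverse_eq_divide flip: exp_of_nat_mult)
    also have "\<dots> \<le> 1 / real n ^ 4"
      using n by (intro divide_left_mono power_mono real_le_exp_log_size) auto
    finally show "?e \<le> 1 / real n ^ 4" .
  qed auto
  also have "\<dots> = 9 / real n" using n by (simp add: power2_eq_square power4_eq_xxxx)
  finally have "measure_pmf.prob (rand_alg n) {T. \<not> output_on T E = E} \<le> 9 / real n" .
  moreover have "measure_pmf.prob (rand_alg n) {T. \<not> output_on T E = E}
      = 1 - measure_pmf.prob (rand_alg n) {T. output_on T E = E}"
    using measure_pmf.prob_compl[of "{T. output_on T E = E}" "rand_alg n"]
    by (simp add: Compl_eq_Diff_UNIV[symmetric] Collect_neg_eq)
  ultimately show ?thesis by linarith
qed

lemma rand_alg_solves: "rand_solves_GR_whp rand_alg"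
  unfolding rand_solves_GR_whp_def
proof (intro conjI allI ballI)
  fix n T assume "T \<in> set_pmf (rand_alg n)"
  then obtain fam where "T = rand_tree n fam" by (auto simp: rand_alg_def)
  then show "queries_within {..<n} T"
    unfolding rand_tree_def by (simp only: queries_within_peel order.refl)
next
  let ?p = "\<lambda>n E. measure_pmf.prob (rand_alg n) {T. output_on T E = E}"
  let ?G = "\<lambda>n. {E. simple_graph {..<n::nat} E}"
  \<comment> \<open>The edgeless graph makes the index set nonempty, as bounding a real infimum
    requires.\<close>
  have empty: "{} \<in> ?G n" for n by (simp add: simple_graph_def)
  show "(\<lambda>n. INF E\<in>?G n. ?p n E) \<longlonglongrightarrow> 1"
  proof (rule tendsto_sandwich)
    show "(\<lambda>n. 1 - 9 / real n) \<longlonglongrightarrow> 1"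
      using tendsto_diff[OF tendsto_const lim_const_over_n[of 9]] by simp
    show "\<forall>\<^sub>F n in sequentially. 1 - 9 / real n \<le> (INF E\<in>?G n. ?p n E)"
      using eventually_ge_at_top[of 1]
    proof eventually_elim
      case (elim n)
      show ?case
        using empty[of n] elim by (intro cINF_greatest rand_alg_success) auto
    qed
    have "(INF E\<in>?G n. ?p n E) \<le> ?p n {}" for n
      using empty[of n] by (intro cINF_lower bdd_belowI2[of _ 0]) auto
    then have "(INF E\<in>?G n. ?p n E) \<le> 1" for n
      using measure_pmf.prob_le_1 order.trans by blast
    then show "\<forall>\<^sub>F n in sequentially. (INF E\<in>?G n. ?p n E) \<le> 1" by simp
  qed simp
qed

theorem theorem11:
  shows "(\<exists>R :: rand_algorithm. rand_solves_GR_whp R \<and>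
           (\<exists>C > 0. \<forall>n \<ge> 2. \<forall>E. simple_graph {..<n} E \<longrightarrow>
             (\<forall>T \<in> set_pmf (R n).
                real (num_queries_on T E) \<le> C * (degeneracy1 n E)\<^sup>2 * (ln (real n))\<^sup>2)))
       \<and> (\<exists>A :: det_algorithm. det_solves_GR A \<and>
           (\<exists>C > 0. \<forall>n \<ge> 2. \<forall>E. simple_graph {..<n} E \<longrightarrow>
             real (num_queries_on (A n) E)
               \<le> C * (degeneracy1 n E) ^ 3 * ln (real n) * ln (real n / degeneracy1 n E)))"
proof (intro conjI exI)
  show "\<forall>n \<ge> 2. \<forall>E. simple_graph {..<n} E \<longrightarrow>
      (\<forall>T \<in> set_pmf (rand_alg n).
         real (num_queries_on T E) \<le> 83886080 * (degeneracy1 n E)\<^sup>2 * (ln (real n))\<^sup>2)"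
    using rand_tree_queries by (auto simp: rand_alg_def)
  show "\<forall>n \<ge> 2. \<forall>E. simple_graph {..<n} E \<longrightarrow>
      real (num_queries_on (det_alg n) E)
        \<le> 7864320 * (degeneracy1 n E) ^ 3 * ln (real n) * ln (real n / degeneracy1 n E)"
    using det_alg_queries by blast
qed (use rand_alg_solves det_alg_correct in auto)

end
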